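(* Let $q$ be a power of an odd prime and let $S$ be a multiplicative character on $\mathbb{F}_q$ with order not equal to $1$, $3$, or $4$. If $q\equiv 2\pmod 3$, then $${}_3F_2\left(\begin{array}{ccc}S^{-3}, & S^{-1}, & S^{-2}\phi\\ & S^{-4}, & S^{-2}\end{array}\Big|\ 4\right)=-\frac{\phi(-3)S(16)}{q}.$$ If $q\equiv 1\pmod 3$, then $${}_3F_2\left(\begin{array}{ccc}S^{-3}, & S^{-1}, & S^{-2}\phi\\ & S^{-4}, & S^{-2}\end{array}\Big|\ 4\right)=\frac{S\left(-\frac{16}{27}\right)J(S^{-1},S^{-1})}{J(S^{-3},S)}\left[\binom{S}{\chi_3}+\binom{S}{\chi_3^2}\right]^2-\frac{\phi(-3)S(16)}{q},$$ where $\chi_3$ is a character of order $3$ of $\mathbb{F}_q$.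
   Context: Multiplicative characters on $\mathbb{F}_q^\times$ are complex valued and are all (including the trivial one) extended to $\mathbb{F}_q$ by $\chi(0):=0$; $\phi$ is the quadratic character; $\overline{B}$ is the inverse of $B$. $J(A,B)=\sum_{x\in\mathbb{F}_q}A(x)B(1-x)$ is the Jacobi sum. The binomial coefficient is $\binom{A}{B}:=\frac{B(-1)}{q}J(A,\overline{B})$. Gaussian hypergeometric series over $\mathbb{F}_q$: $${}_3F_2\left(\begin{array}{ccc}A_0,&A_1,&A_2\\&B_1,&B_2\end{array}\Big|\ x\right):=\frac{q}{q-1}\sum_{\chi}\binom{A_0\chi}{\chi}\binom{A_1\chi}{B_1\chi}\binom{A_2\chi}{B_2\chi}\chi(x),$$ the sum being over all multiplicative characters $\chi$ of $\mathbb{F}_q$. *)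

theory Defs
  imports Complex_Main "HOL-Library.Cardinality" "HOL-Computational_Algebra.Primes" "HOL-Algebra.Multiplicative_Group"
begin

text \<open>
  A multiplicative character is a homomorphism from the nonzero elements to the nonzero complex
  numbers, extended by zero. Since the extension applies to the trivial character as well, the unit
  of the group vanishes at 0.
\<close>
definition mult_chars :: "('a::finite_field \<Rightarrow> complex) monoid" where
  "mult_chars =
     \<lparr>carrier = {\<chi>. \<chi> 0 = 0 \<and> (\<forall>x. x \<noteq> 0 \<longrightarrow> \<chi> x \<noteq> 0) \<and>
                    (\<forall>x y. x \<noteq> 0 \<longrightarrow> y \<noteq> 0 \<longrightarrow> \<chi> (x * y) = \<chi> x * \<chi> y)},
      mult = (\<lambda>\<chi> \<psi> x. \<chi> x * \<psi> x),
      one = (\<lambda>x. if x = 0 then 0 else 1)\<rparr>"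

lemma mult_chars_iff:
  "\<chi> \<in> carrier mult_chars \<longleftrightarrow> \<chi> 0 = 0 \<and> \<chi> 1 = 1 \<and> (\<forall>x y. \<chi> (x * y) = \<chi> x * \<chi> y)"
  (is "?L \<longleftrightarrow> ?R")
proof
  assume L: ?L
  then have "\<chi> (1 * 1) = \<chi> 1 * \<chi> 1" "\<chi> 1 \<noteq> 0"
    unfolding mult_chars_def by (simp_all del: mult_1_left mult_1_right)
  then have "\<chi> 1 = 1"
    by simp
  moreover have "\<chi> (x * y) = \<chi> x * \<chi> y" for x y
    using L by (cases "x = 0 \<or> y = 0") (auto simp: mult_chars_def)
  ultimately show ?R
    using L by (simp add: mult_chars_def)
next
  assume R: ?R
  have "\<chi> x \<noteq> 0" if "x \<noteq> 0" for x
  proof -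
    have "\<chi> x * \<chi> (inverse x) = 1"
      using R that by (metis right_inverse)
    then show ?thesis
      by auto
  qed
  with R show ?L
    by (simp add: mult_chars_def)
qed

lemma mult_chars_simps [simp]:
  "(\<chi> \<otimes>\<^bsub>mult_chars\<^esub> \<psi>) x = \<chi> x * \<psi> x"
  "\<one>\<^bsub>mult_chars\<^esub> x = (if x = 0 then 0 else 1)"
  by (simp_all add: mult_chars_def)

lemma comm_group_mult_chars: "comm_group (mult_chars :: ('a::finite_field \<Rightarrow> complex) monoid)"
proof (rule comm_groupI)
  fix \<chi> :: "'a \<Rightarrow> complex"
  assume \<chi>: "\<chi> \<in> carrier mult_chars"
  show "\<exists>\<psi>\<in>carrier mult_chars. \<psi> \<otimes>\<^bsub>mult_chars\<^esub> \<chi> = \<one>\<^bsub>mult_chars\<^esub>"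
    by (rule bexI[of _ "\<lambda>x. inverse (\<chi> x)"]) (use \<chi> in \<open>auto simp: mult_chars_def fun_eq_iff\<close>)
qed (auto simp: mult_chars_def fun_eq_iff)

interpretation mult_chars: comm_group "mult_chars :: ('a::finite_field \<Rightarrow> complex) monoid"
  by (rule comm_group_mult_chars)

lemma mult_chars_inv:
  assumes "\<chi> \<in> carrier mult_chars"
  shows "inv\<^bsub>mult_chars\<^esub> \<chi> = (\<lambda>x. inverse (\<chi> x))"
  by (rule mult_chars.inv_equality)
    (use assms in \<open>auto simp: mult_chars_def fun_eq_iff\<close>)

lemma finite_mult_chars: "finite (carrier (mult_chars :: ('a::finite_field \<Rightarrow> complex) monoid))"
proof (rule finite_subset)
  let ?B = "insert 0 {z :: complex. z ^ (CARD('a) - 1) = 1}"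
  have "CARD('a) > card {0 :: 'a}"
  proof (rule psubset_card_mono)
    have "(1 :: 'a) \<notin> {0}"
      by simp
    then show "{0 :: 'a} \<subset> UNIV"
      by (metis UNIV_I psubsetI subset_UNIV)
  qed simp
  then have card: "CARD('a) - 1 \<ge> 1"
    by simp
  show "finite {\<chi> :: 'a \<Rightarrow> complex. \<forall>x. (x \<in> UNIV \<longrightarrow> \<chi> x \<in> ?B) \<and> (x \<notin> UNIV \<longrightarrow> \<chi> x = 0)}"
    using card by (intro finite_set_of_finite_funs) (auto intro!: finite_roots_unity)
  show "carrier mult_chars \<subseteq>
    {\<chi> :: 'a \<Rightarrow> complex. \<forall>x. (x \<in> UNIV \<longrightarrow> \<chi> x \<in> ?B) \<and> (x \<notin> UNIV \<longrightarrow> \<chi> x = 0)}"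
  proof
    fix \<chi> :: "'a \<Rightarrow> complex"
    assume \<chi>: "\<chi> \<in> carrier mult_chars"
    have "\<chi> x \<in> ?B" for x
    proof -
      have "\<chi> (x ^ k) = \<chi> x ^ k" for k
        using \<chi> by (induction k) (auto simp: mult_chars_iff)
      then have "\<chi> x ^ Suc (CARD('a) - 1) = \<chi> x"
        using card finite_field_power_card_eq_same[of x] by (metis Suc_diff_1 zero_less_card_finite)
      then have "\<chi> x = 0 \<or> \<chi> x ^ (CARD('a) - 1) = 1"
        by (metis mult_cancel_left2 power_Suc)
      then show ?thesis
        by simp
    qed
    then show "\<chi> \<in> {\<chi>. \<forall>x. (x \<in> UNIV \<longrightarrow> \<chi> x \<in> ?B) \<and> (x \<notin> UNIV \<longrightarrow> \<chi> x = 0)}"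
      by simp
  qed
qed

definition quad_char :: "'a::finite_field \<Rightarrow> complex" where
  "quad_char x = (if x = 0 then 0 else if \<exists>y. x = y\<^sup>2 then 1 else -1)"

definition jacobi_sum :: "('a::finite_field \<Rightarrow> complex) \<Rightarrow> ('a \<Rightarrow> complex) \<Rightarrow> complex" where
  "jacobi_sum A B = (\<Sum>x\<in>UNIV. A x * B (1 - x))"

definition char_binomial :: "('a::finite_field \<Rightarrow> complex) \<Rightarrow> ('a \<Rightarrow> complex) \<Rightarrow> complex" where
  "char_binomial A B = B (-1) / of_nat CARD('a) * jacobi_sum A (inv\<^bsub>mult_chars\<^esub> B)"

definition hypergeom_3F2 ::
  "('a::finite_field \<Rightarrow> complex) \<Rightarrow> ('a \<Rightarrow> complex) \<Rightarrow> ('a \<Rightarrow> complex) \<Rightarrow>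
   ('a \<Rightarrow> complex) \<Rightarrow> ('a \<Rightarrow> complex) \<Rightarrow> 'a \<Rightarrow> complex" where
  "hypergeom_3F2 A0 A1 A2 B1 B2 x =
     of_nat CARD('a) / (of_nat CARD('a) - 1) *
     (\<Sum>\<chi>\<in>carrier mult_chars.
        char_binomial (A0 \<otimes>\<^bsub>mult_chars\<^esub> \<chi>) \<chi> *
        char_binomial (A1 \<otimes>\<^bsub>mult_chars\<^esub> \<chi>) (B1 \<otimes>\<^bsub>mult_chars\<^esub> \<chi>) *
        char_binomial (A2 \<otimes>\<^bsub>mult_chars\<^esub> \<chi>) (B2 \<otimes>\<^bsub>mult_chars\<^esub> \<chi>) * \<chi> x)"

end

theory Submission
  imports Defs
begin

text \<open>
  Put \<open>T = S\<inverse>\<close> and \<open>q = CARD('a)\<close>. Orthogonality of characters turns the hypergeometric sum into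
  \<open>S 16 / q\<^sup>2\<close> times the double sum \<open>reduced_sum T\<close>. Its curves
  \<open>x * (1 - x)\<^sup>2 = t * y * (1 - y)\<^sup>2\<close> are nodal cubics; parametrizing them by the slope
  \<open>m = (1 - x) / (1 - y)\<close> leaves quadratic character sums over the quartics \<open>quartic t\<close>, which are
  curves of genus one and \<open>j\<close>-invariant 0 and hence isomorphic to \<open>w\<^sup>2 = 4 * n ^ 3 + (t * (1 - t))\<^sup>2\<close>.
  If \<open>q mod 3 = 2\<close>, cubing is a bijection and these sums vanish. If \<open>q mod 3 = 1\<close>, cubic characters
  give \<open>reduced_sum T = P T * P S - q\<close> with \<open>P T = (\<Sum>u. T (1 + u ^ 3))\<close>, and \<open>P S\<close> is \<open>q\<close> times the
  sum of the two binomial coefficients. Finally \<open>P T\<close> is expressed by \<open>P S\<close> through the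
  Hasse--Davenport relation for the prime 3.
\<close>

subsection \<open>Multiplicative characters\<close>

text \<open>The three excluded orders are what makes \<open>T\<close>, \<open>T^3\<close> and
  \<open>T^2\<close> times the quadratic character nontrivial. The slope \<open>m\<close> does not
  parametrize the diagonal \<open>x = y\<close>, and it never meets the curves
  \<open>t = m^2\<close> and \<open>t = m^3\<close>. Completing the sum to all \<open>(m, t)\<close>
  introduces sums of exactly these three characters, and the constants they leave behind, with
  values of the quadratic character at -1 and -3, cancel against the diagonal. What remains is q
  plus the sum of \<open>T t\<close> times the genus-one sum for t, while \<open>P T * P S\<close>
  is 2q plus the same sum; hence the -q. The factor phi(-3) in the theorem is not a remnant of that
  cancellation. It is the sign that separates the two residues of q modulo 3 and turns q into
  -phi(-3) q in one case and -q into -phi(-3) q in the other. Gauss sums would require additive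
  characters. Products of Jacobi sums are instead obtained by the substitution
  \<open>x = t * y\<close>.\<close>

lemma
  assumes "\<chi> \<in> carrier mult_chars"
  shows char_0: "\<chi> 0 = 0"
    and char_1: "\<chi> 1 = 1"
    and char_mult: "\<chi> (x * y) = \<chi> x * \<chi> y"
    and char_eq_0_iff: "\<chi> x = 0 \<longleftrightarrow> x = 0"
proof -
  show "\<chi> 0 = 0" "\<chi> 1 = 1" "\<chi> (x * y) = \<chi> x * \<chi> y"
    using assms by (auto simp: mult_chars_iff)
  show "\<chi> x = 0 \<longleftrightarrow> x = 0"
    using assms by (auto simp: mult_chars_def)
qed

lemmas char_simps = char_0 char_1 char_eq_0_iff

lemma char_inverse:
  assumes "\<chi> \<in> carrier mult_chars"
  shows "\<chi> (inverse x) = inverse (\<chi> x)"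
proof (cases "x = 0")
  case False
  then have "\<chi> x * \<chi> (inverse x) = 1"
    using char_mult[OF assms, of x "inverse x"] char_1[OF assms] by simp
  then show ?thesis
    by (metis inverse_unique)
qed (simp add: char_0[OF assms])

lemma char_divide:
  assumes "\<chi> \<in> carrier mult_chars"
  shows "\<chi> (x / y) = \<chi> x / \<chi> y"
  by (simp add: divide_inverse char_mult[OF assms] char_inverse[OF assms])

lemma char_power:
  assumes "\<chi> \<in> carrier mult_chars"
  shows "\<chi> (x ^ n) = \<chi> x ^ n"
  by (induction n) (simp_all add: char_mult[OF assms] char_1[OF assms])

lemma char_minus_1_sq: "\<chi> \<in> carrier mult_chars \<Longrightarrow> \<chi> (-1) * \<chi> (-1) = 1"
  using char_mult[of \<chi> "-1" "-1"] char_1[of \<chi>] by simp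

lemma mult_in_chars:
  "A \<in> carrier mult_chars \<Longrightarrow> B \<in> carrier mult_chars \<Longrightarrow> (\<lambda>x. A x * B x) \<in> carrier mult_chars"
  by (simp add: mult_chars_iff)

lemma inverse_in_chars:
  "A \<in> carrier mult_chars \<Longrightarrow> (\<lambda>x. inverse (A x)) \<in> carrier mult_chars"
  by (simp add: mult_chars_iff)

lemma power_in_chars:
  "A \<in> carrier mult_chars \<Longrightarrow> n > 0 \<Longrightarrow> (\<lambda>x. A x ^ n) \<in> carrier mult_chars"
  by (simp add: mult_chars_iff power_mult_distrib)

lemma nontrivial_charE:
  assumes "\<chi> \<in> carrier mult_chars" "\<chi> \<noteq> \<one>\<^bsub>mult_chars\<^esub>"
  obtains c where "c \<noteq> 0" "\<chi> c \<noteq> 1"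
  using assms char_0[OF assms(1)] by (metis ext mult_chars_simps(2))

section \<open>Reindexing of sums over the field\<close>

lemma sum_affine:
  fixes f :: "'a::finite_field \<Rightarrow> complex"
  assumes "a \<noteq> 0"
  shows "(\<Sum>x\<in>UNIV. f (a * x + b)) = sum f UNIV"
  by (rule sum.reindex_bij_witness[of _ "\<lambda>y. (y - b) / a" "\<lambda>x. a * x + b"]) (use assms in auto)

lemma sum_scale:
  fixes f :: "'a::finite_field \<Rightarrow> complex"
  assumes "a \<noteq> 0"
  shows "(\<Sum>x\<in>UNIV. f (a * x)) = sum f UNIV"
  using sum_affine[OF assms, of f 0] by simp

lemma sum_reflect:
  fixes f :: "'a::finite_field \<Rightarrow> complex"
  shows "(\<Sum>x\<in>UNIV. f (b - x)) = sum f UNIV"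
  using sum_affine[of "-1" f b] by simp

lemma sum_fiber:
  fixes f :: "'b::finite \<Rightarrow> complex" and h :: "'a::finite \<Rightarrow> 'b"
  shows "(\<Sum>z\<in>UNIV. f (h z)) = (\<Sum>A\<in>UNIV. of_nat (card {z. h z = A}) * f A)"
proof -
  have "(\<Sum>z\<in>UNIV. f (h z)) = (\<Sum>A\<in>UNIV. \<Sum>z\<in>{z\<in>UNIV. h z = A}. f (h z))"
    by (rule sum.group[symmetric]) auto
  also have "\<dots> = (\<Sum>A\<in>UNIV. of_nat (card {z. h z = A}) * f A)"
    by (intro sum.cong) auto
  finally show ?thesis .
qed

lemma sum_remove:
  fixes f :: "'b::finite \<Rightarrow> complex"
  shows "(\<Sum>x\<in>UNIV - {a}. f x) = sum f UNIV - f a"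
  by (simp add: sum_diff1)

lemma sum_char:
  assumes "\<chi> \<in> carrier mult_chars" "\<chi> \<noteq> \<one>\<^bsub>mult_chars\<^esub>"
  shows "(\<Sum>x\<in>UNIV. \<chi> x) = 0"
proof -
  obtain c where c: "c \<noteq> 0" "\<chi> c \<noteq> 1"
    using nontrivial_charE[OF assms] by blast
  have "(\<Sum>x\<in>UNIV. \<chi> x) = (\<Sum>x\<in>UNIV. \<chi> (c * x))"
    using sum_scale[OF c(1), of \<chi>] by simp
  also have "\<dots> = \<chi> c * (\<Sum>x\<in>UNIV. \<chi> x)"
    by (simp add: char_mult[OF assms(1)] sum_distrib_left)
  finally show ?thesis
    using c(2) by auto
qed

lemma card_finite_field_ge_2: "CARD('a::finite_field) \<ge> 2"
proof -
  have "card {0, 1 :: 'a} \<le> CARD('a)"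
    by (rule card_mono) auto
  then show ?thesis by simp
qed

lemma finite_field_power_card_minus_1:
  fixes x :: "'a::finite_field"
  assumes "x \<noteq> 0"
  shows "x ^ (CARD('a) - 1) = 1"
proof -
  have "x * x ^ (CARD('a) - 1) = x"
    using finite_field_power_card_eq_same[of x] card_finite_field_ge_2[where 'a = 'a]
    by (metis One_nat_def Suc_diff_1 less_eq_Suc_le order_trans one_le_numeral power_Suc)
  then show ?thesis
    using assms by simp
qed

section \<open>Generators, duality and orthogonality of characters\<close>

lemma generator_exists:
  "\<exists>g::'a::finite_field. g \<noteq> 0 \<and> (\<forall>x. x \<noteq> 0 \<longrightarrow> (\<exists>i::nat. x = g ^ i))"
proof -
  let ?R = "\<lparr>carrier = UNIV, monoid.mult = (*), one = 1, ring.zero = 0, add = (+)\<rparr> :: 'a ring"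
  have "\<exists>y. x + y = 0" for x :: 'a
    using add.right_inverse by blast
  moreover have "x \<noteq> 0 \<Longrightarrow> \<exists>y. x * y = 1" for x :: 'a
    by (rule exI[of _ "inverse x"]) auto
  ultimately interpret R: field ?R
    using add.right_inverse by unfold_locales (auto simp: algebra_simps Units_def)
  have pow: "a [^]\<^bsub>?R\<^esub> i = a ^ i" for a :: 'a and i :: nat
    by (induction i) (simp_all add: mult.commute)
  have "finite (carrier ?R)"
    by simp
  from R.finite_field_mult_group_has_gen[OF this] obtain g where
    g: "g \<in> carrier (mult_of ?R)" "carrier (mult_of ?R) = {g [^]\<^bsub>?R\<^esub> i | i::nat. i \<in> UNIV}"
    by blast
  have car: "carrier (mult_of ?R) = UNIV - {0}"
    by simp
  show ?thesis
    using g unfolding car pow by (intro exI[of _ g]) auto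
qed

text \<open>A generator is sent to a primitive root of unity of order n = q - 1. The discrete
  logarithm of any z other than 0 and 1 is not divisible by n, so its image is not 1.\<close>

lemma separating_char_exists:
  fixes z :: "'a::finite_field"
  assumes "z \<noteq> 0" "z \<noteq> 1"
  shows "\<exists>\<chi>\<in>carrier mult_chars. \<chi> z \<noteq> 1"
proof -
  define n where "n = CARD('a) - 1"
  have n: "n > 0"
    using card_finite_field_ge_2[where 'a = 'a] by (simp add: n_def)
  obtain g :: 'a where g: "g \<noteq> 0" "\<And>x. x \<noteq> 0 \<Longrightarrow> \<exists>i::nat. x = g ^ i"
    using generator_exists by blast
  have gn: "g ^ n = 1"
    using finite_field_power_card_minus_1[OF g(1)] by (simp add: n_def)
  have gmod: "g ^ (i mod n) = g ^ i" for i
    by (metis gn mult_div_mod_eq power_add power_mult power_one mult_1)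
  have "(\<lambda>i. g ^ i) ` {..<n} = UNIV - {0}"
  proof safe
    fix x :: 'a assume "x \<notin> (\<lambda>i. g ^ i) ` {..<n}"
    moreover have "x \<in> (\<lambda>i. g ^ i) ` {..<n}" if "x \<noteq> 0"
      using g(2)[OF that] gmod n by (metis image_eqI lessThan_iff mod_less_divisor)
    ultimately show "x = 0" by blast
  qed (use g in auto)
  moreover have "card (UNIV - {0::'a}) = n"
    by (simp add: n_def card_Diff_singleton)
  ultimately have inj: "inj_on (\<lambda>i. g ^ i) {..<n}"
    by (intro eq_card_imp_inj_on) auto
  \<comment> \<open>Any choice of exponent would do: a discrete logarithm is determined only modulo
    n, and only its residue enters the value of the character.\<close>
  define ind where "ind x = (LEAST i. x = g ^ i)" for x
  have ind: "g ^ ind x = x" if "x \<noteq> 0" for x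
    unfolding ind_def using LeastI_ex[OF g(2)[OF that]] by simp
  have ind_mod: "ind x mod n = i mod n" if "x = g ^ i" for x i
  proof (rule inj_onD[OF inj])
    show "g ^ (ind x mod n) = g ^ (i mod n)"
      unfolding gmod using ind[of x] that g(1) by simp
  qed (use n in auto)
  define \<omega> where "\<omega> = cis (2 * pi / n)"
  have \<omega>n: "\<omega> ^ n = 1"
    using n by (simp add: \<omega>_def DeMoivre)
  have \<omega>mod: "\<omega> ^ (i mod n) = \<omega> ^ i" for i
    by (metis \<omega>n mult_div_mod_eq power_add power_mult power_one mult_1)
  have \<omega>ord: "\<omega> ^ i \<noteq> 1" if "0 < i" "i < n" for i
  proof
    assume "\<omega> ^ i = 1"
    then have "cis (2 * pi * i / n) = 1"
      by (simp add: \<omega>_def DeMoivre mult.commute)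
    then have "cos (2 * pi * i / n) = 1"
      by (metis cis.sel(1) one_complex.sel(1))
    then obtain k :: int where "2 * pi * i / n = k * (2 * pi)"
      by (auto simp: cos_one_2pi_int mult.commute mult.left_commute)
    then have "real i = of_int k * real n"
      using n by (simp add: field_simps)
    then have k: "int i = k * int n"
      by (metis of_int_eq_iff of_int_mult of_int_of_nat_eq)
    then have "k > 0"
      using that by (metis mult_le_0_iff not_le of_nat_0_le_iff of_nat_0_less_iff)
    then have "int n \<le> int i"
      using k by (simp add: mult_le_cancel_right1)
    then show False
      using that by simp
  qed
  define \<chi> where "\<chi> x = (if x = 0 then 0 else \<omega> ^ ind x)" for x
  have "\<chi> \<in> carrier mult_chars"
  proof -
    have "ind 1 mod n = 0"
      using ind_mod[of 1 0] by simp
    then have "\<chi> 1 = 1"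
      using \<omega>mod[of "ind 1"] by (simp add: \<chi>_def)
    moreover have "\<chi> (x * y) = \<chi> x * \<chi> y" for x y
    proof (cases "x = 0 \<or> y = 0")
      case False
      then have "x * y = g ^ (ind x + ind y)"
        by (simp add: power_add ind)
      then have "ind (x * y) mod n = (ind x + ind y) mod n"
        by (rule ind_mod)
      then have "\<omega> ^ ind (x * y) = \<omega> ^ (ind x + ind y)"
        by (metis \<omega>mod)
      then show ?thesis
        using False by (simp add: \<chi>_def power_add)
    qed (auto simp: \<chi>_def)
    ultimately show ?thesis
      by (simp add: mult_chars_iff \<chi>_def)
  qed
  moreover have "\<chi> z \<noteq> 1"
  proof -
    have "ind z mod n \<noteq> 0"
      using ind[OF assms(1)] gmod[of "ind z"] assms(2) by (metis power_0)
    then have "\<omega> ^ (ind z mod n) \<noteq> 1"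
      using n by (intro \<omega>ord) auto
    then show ?thesis
      using assms(1) by (simp add: \<chi>_def \<omega>mod)
  qed
  ultimately show ?thesis by blast
qed

lemma sum_over_chars_eq_0:
  fixes z :: "'a::finite_field"
  assumes "z \<noteq> 1"
  shows "(\<Sum>\<chi>\<in>carrier mult_chars. \<chi> z) = 0"
proof (cases "z = 0")
  case True
  then show ?thesis by (simp add: char_0)
next
  case False
  obtain \<psi> :: "'a \<Rightarrow> complex" where \<psi>: "\<psi> \<in> carrier mult_chars" "\<psi> z \<noteq> 1"
    using separating_char_exists[OF False assms] by blast
  have "(\<Sum>\<chi>\<in>carrier mult_chars. \<chi> z) = (\<Sum>\<chi>\<in>carrier mult_chars. (\<psi> \<otimes>\<^bsub>mult_chars\<^esub> \<chi>) z)"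
    by (rule sum.reindex_bij_witness[of _ "\<lambda>\<chi>. \<psi> \<otimes>\<^bsub>mult_chars\<^esub> \<chi>"
          "\<lambda>\<chi>. inv\<^bsub>mult_chars\<^esub> \<psi> \<otimes>\<^bsub>mult_chars\<^esub> \<chi>"])
      (use \<psi> in \<open>auto simp: mult_chars.m_assoc[symmetric] simp del: mult_chars_simps\<close>)
  also have "\<dots> = \<psi> z * (\<Sum>\<chi>\<in>carrier mult_chars. \<chi> z)"
    by (simp add: sum_distrib_left)
  finally show ?thesis
    using \<psi>(2) by auto
qed

text \<open>The double sum of \<chi> z is evaluated in both orders: only z = 1 survives one
  summation, only the trivial character the other.\<close>

lemma card_chars: "card (carrier (mult_chars :: ('a::finite_field \<Rightarrow> complex) monoid)) = CARD('a) - 1"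
proof -
  let ?C = "carrier (mult_chars :: ('a \<Rightarrow> complex) monoid)"
  have one_sum: "(\<Sum>z\<in>UNIV. \<one>\<^bsub>mult_chars\<^esub> (z :: 'a)) = (of_nat (CARD('a) - 1) :: complex)"
    by (simp add: sum.If_cases Compl_eq_Diff_UNIV)
  have "(\<Sum>z\<in>UNIV. \<Sum>\<chi>\<in>?C. \<chi> z) = (\<Sum>z\<in>(UNIV :: 'a set). if z = 1 then of_nat (card ?C) else 0)"
    by (intro sum.cong) (auto simp: sum_over_chars_eq_0 char_1)
  then have "of_nat (card ?C) = (\<Sum>z\<in>UNIV. \<Sum>\<chi>\<in>?C. \<chi> z)"
    by simp
  also have "\<dots> = (\<Sum>\<chi>\<in>?C. \<Sum>z\<in>UNIV. \<chi> z)"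
    by (rule sum.swap)
  also have "\<dots> = (\<Sum>\<chi>\<in>?C. if \<chi> = \<one>\<^bsub>mult_chars\<^esub> then of_nat (CARD('a) - 1) else 0)"
    by (intro sum.cong) (auto simp: one_sum sum_char simp del: mult_chars_simps)
  also have "\<dots> = of_nat (CARD('a) - 1)"
    by (subst sum.delta) (auto simp: finite_mult_chars)
  finally show ?thesis
    by (metis of_nat_eq_iff)
qed

lemma sum_over_chars:
  fixes z :: "'a::finite_field"
  shows "(\<Sum>\<chi>\<in>carrier mult_chars. \<chi> z) = (if z = 1 then of_nat CARD('a) - 1 else 0)"
proof (cases "z = 1")
  case True
  have "(\<Sum>\<chi>\<in>carrier mult_chars. \<chi> (1 :: 'a)) = of_nat (CARD('a) - 1)"
    by (simp add: char_1 card_chars)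
  then show ?thesis
    using True card_finite_field_ge_2[where 'a = 'a] by (simp add: of_nat_diff)
qed (simp add: sum_over_chars_eq_0)

section \<open>Characteristic of the field and the quadratic character\<close>

lemma CHAR_dvd_CARD_finite_field: "CHAR('a::finite_field) dvd CARD('a)"
proof -
  let ?G = "\<lparr>carrier = UNIV, monoid.mult = (+), one = 0\<rparr> :: 'a monoid"
  interpret group ?G
    by (rule groupI) (auto simp: algebra_simps intro: exI[of _ "- x" for x])
  have pow: "a [^]\<^bsub>?G\<^esub> n = of_nat n * a" for a and n :: nat
    by (induction n) (simp_all add: algebra_simps)
  have "1 [^]\<^bsub>?G\<^esub> n = \<one>\<^bsub>?G\<^esub> \<longleftrightarrow> CHAR('a) dvd n" for n :: nat
    by (simp add: pow of_nat_eq_0_iff_char_dvd)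
  moreover have "1 [^]\<^bsub>?G\<^esub> order ?G = \<one>\<^bsub>?G\<^esub>"
    by (rule pow_order_eq_1) simp
  ultimately show ?thesis
    by (simp add: order_def)
qed

lemma of_nat_prime_nonzero:
  assumes "prime l" "\<not> l dvd CARD('a::finite_field)"
  shows "(of_nat l :: 'a) \<noteq> 0"
proof
  assume "(of_nat l :: 'a) = 0"
  then have "CHAR('a) dvd l"
    by (simp add: of_nat_eq_0_iff_char_dvd)
  then have "CHAR('a) = l"
    using assms(1) by (metis CHAR_prime primes_dvd_imp_eq)
  then show False
    using CHAR_dvd_CARD_finite_field[where 'a = 'a] assms by simp
qed

lemma quad_char_0 [simp]: "quad_char 0 = 0"
  and quad_char_1 [simp]: "quad_char 1 = 1"
  by (auto simp: quad_char_def intro: exI[of _ 1])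

lemma quad_char_sq: "x \<noteq> 0 \<Longrightarrow> quad_char (x\<^sup>2) = 1"
  by (auto simp: quad_char_def)

lemma four_nonzero: "(2 :: 'a::finite_field) \<noteq> 0 \<Longrightarrow> (4 :: 'a) \<noteq> 0"
  by (metis mult_eq_0_iff mult_2 numeral_Bit0)

text \<open>Squaring identifies 1 and -1, so on a finite field it is not injective and hence not
  surjective.\<close>

lemma nonsquare_exists:
  assumes "(2 :: 'a::finite_field) \<noteq> 0"
  shows "\<exists>x::'a. \<forall>y. x \<noteq> y\<^sup>2"
proof (rule ccontr)
  assume "\<not> ?thesis"
  then have "surj (\<lambda>y::'a. y\<^sup>2)"
    by (auto simp: surj_def)
  then have "inj (\<lambda>y::'a. y\<^sup>2)"
    by (simp add: finite_UNIV_surj_inj)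
  then have "(1 :: 'a) = -1"
    by (rule injD) simp
  then have "(2 :: 'a) = 0"
    by (metis add.left_inverse one_add_one)
  with assms show False by simp
qed

text \<open>A generator is not a square, since otherwise every element would be one. Squares are
  therefore the even powers, and multiplicativity of the quadratic character becomes additivity of
  parity.\<close>

lemma quad_char_generator_power:
  fixes g :: "'a::finite_field"
  assumes "(2 :: 'a) \<noteq> 0" "g \<noteq> 0" "\<And>x. x \<noteq> 0 \<Longrightarrow> \<exists>i::nat. x = g ^ i"
  shows "quad_char (g ^ i) = (-1) ^ i"
proof -
  have nsq: "g \<noteq> y\<^sup>2" for y
  proof
    assume "g = y\<^sup>2"
    moreover obtain x :: 'a where x: "\<And>y. x \<noteq> y\<^sup>2"
      using nonsquare_exists[OF assms(1)] by blast
    moreover from x[of 0] obtain i where "x = g ^ i"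
      using assms(3)[of x] by auto
    ultimately have "x = (y ^ i)\<^sup>2"
      by (simp flip: power_mult add: mult.commute)
    with x show False by blast
  qed
  show ?thesis
  proof (cases "even i")
    case True
    then obtain j where "i = 2 * j" by blast
    then have "g ^ i = (g ^ j)\<^sup>2"
      by (simp flip: power_mult add: mult.commute)
    with True assms(2) show ?thesis
      by (simp add: quad_char_sq)
  next
    case False
    then obtain j where i: "i = Suc (2 * j)" by (metis oddE Suc_eq_plus1)
    have "g ^ i \<noteq> y\<^sup>2" for y
    proof
      assume "g ^ i = y\<^sup>2"
      then have "g * (g ^ j)\<^sup>2 = y\<^sup>2"
        by (simp add: i power_mult mult.commute flip: power_mult)
      then have "g = (y / g ^ j)\<^sup>2"
        using assms(2) by (simp add: power_divide field_simps)
      with nsq show False by blast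
    qed
    with False assms(2) show ?thesis
      by (auto simp: quad_char_def)
  qed
qed

lemma quad_char_in_chars:
  assumes "(2 :: 'a::finite_field) \<noteq> 0"
  shows "(quad_char :: 'a \<Rightarrow> complex) \<in> carrier mult_chars"
proof -
  obtain g :: 'a where g: "g \<noteq> 0" "\<And>x. x \<noteq> 0 \<Longrightarrow> \<exists>i::nat. x = g ^ i"
    using generator_exists by blast
  have "quad_char (x * y) = quad_char x * quad_char y" for x y :: 'a
  proof (cases "x = 0 \<or> y = 0")
    case False
    then obtain i j where "x = g ^ i" "y = g ^ j"
      using g(2) by meson
    then show ?thesis
      using quad_char_generator_power[OF assms g] by (simp flip: power_add)
  qed auto
  then show ?thesis
    by (simp add: mult_chars_iff)
qed

lemma quad_char_nontrivial:
  assumes "(2 :: 'a::finite_field) \<noteq> 0"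
  shows "(quad_char :: 'a \<Rightarrow> complex) \<noteq> \<one>\<^bsub>mult_chars\<^esub>"
proof -
  obtain x :: 'a where x: "\<And>y. x \<noteq> y\<^sup>2"
    using nonsquare_exists[OF assms(1)] by blast
  then have "x \<noteq> 0"
    by (metis zero_power2)
  then have "quad_char x \<noteq> \<one>\<^bsub>mult_chars\<^esub> x"
    using x by (simp add: quad_char_def)
  then show ?thesis by metis
qed

text \<open>The bridge between point counts and character sums; the convention
  \<open>quad_char 0 = 0\<close> accounts for the single root at 0.\<close>

lemma card_square_roots:
  fixes A :: "'a::finite_field"
  assumes "(2 :: 'a) \<noteq> 0"
  shows "of_nat (card {z. z\<^sup>2 = A}) = 1 + quad_char A"
proof (cases "\<exists>y. A = y\<^sup>2")
  case True
  then obtain y where y: "A = y\<^sup>2" by blast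
  have "{z. z\<^sup>2 = A} = {y, -y}"
    by (auto simp: y power2_eq_iff)
  moreover have "y = -y \<longleftrightarrow> y = 0"
    using assms by (metis add.inverse_neutral add_eq_0_iff2 mult_2 mult_eq_0_iff)
  ultimately show ?thesis
    by (cases "y = 0") (auto simp: y quad_char_sq)
next
  case False
  then have "{z. z\<^sup>2 = A} = {}" "A \<noteq> 0"
    by auto
  with False show ?thesis
    by (simp add: quad_char_def)
qed

subsection \<open>Jacobi sums\<close>

lemma jacobi_sum_commute: "jacobi_sum A B = jacobi_sum B A"
  unfolding jacobi_sum_def
  by (subst sum_reflect[of _ 1, symmetric]) (simp add: mult.commute)

text \<open>For y nonzero, \<open>x = t * y\<close> turns T(x) / T(y) into T(t). At y = 0 the left
  side contributes nothing and the right side a multiple of the full sum of T, which is 0. Keeping B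
  and C arbitrary lets one identity serve both product formulas below.\<close>

lemma jacobi_sum_times_jacobi_sum_inverse:
  fixes T B C :: "'a::finite_field \<Rightarrow> complex"
  assumes T: "T \<in> carrier mult_chars" "T \<noteq> \<one>\<^bsub>mult_chars\<^esub>"
  shows "jacobi_sum T B * jacobi_sum (\<lambda>x. inverse (T x)) C =
    (\<Sum>t\<in>UNIV. T t * (\<Sum>y\<in>UNIV. B (1 - t * y) * C (1 - y)))"
proof -
  have inner: "(\<Sum>x\<in>UNIV. T x * B (1 - x) * (inverse (T y) * C (1 - y))) =
      (\<Sum>t\<in>UNIV. T t * (B (1 - t * y) * C (1 - y)))" for y
  proof (cases "y = 0")
    case True
    then show ?thesis
      by (simp add: char_0[OF T(1)] sum_char[OF T] flip: sum_distrib_right)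
  next
    case False
    have "(\<Sum>x\<in>UNIV. T x * B (1 - x) * (inverse (T y) * C (1 - y))) =
        (\<Sum>t\<in>UNIV. T (y * t) * B (1 - y * t) * (inverse (T y) * C (1 - y)))"
      using sum_scale[OF False, of "\<lambda>x. T x * B (1 - x) * (inverse (T y) * C (1 - y))"] by simp
    also have "\<dots> = (\<Sum>t\<in>UNIV. T t * (B (1 - t * y) * C (1 - y)))"
      using False by (intro sum.cong) (simp_all add: char_mult[OF T(1)] char_eq_0_iff[OF T(1)] mult.commute)
    finally show ?thesis .
  qed
  have "jacobi_sum T B * jacobi_sum (\<lambda>x. inverse (T x)) C =
      (\<Sum>y\<in>UNIV. \<Sum>x\<in>UNIV. T x * B (1 - x) * (inverse (T y) * C (1 - y)))"
    unfolding jacobi_sum_def sum_product by (rule sum.swap)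
  also have "\<dots> = (\<Sum>t\<in>UNIV. \<Sum>y\<in>UNIV. T t * (B (1 - t * y) * C (1 - y)))"
    unfolding inner by (rule sum.swap)
  finally show ?thesis
    by (simp add: sum_distrib_left)
qed

text \<open>The classical absolute value formula for Jacobi sums. The inner sum over y is evaluated
  for each t: it is -B(t), with an additional q at t = 1.\<close>

lemma jacobi_sum_times_inverse:
  fixes A B :: "'a::finite_field \<Rightarrow> complex"
  assumes A: "A \<in> carrier mult_chars" "A \<noteq> \<one>\<^bsub>mult_chars\<^esub>"
    and B: "B \<in> carrier mult_chars" "B \<noteq> \<one>\<^bsub>mult_chars\<^esub>"
    and AB: "(\<lambda>x. A x * B x) \<noteq> \<one>\<^bsub>mult_chars\<^esub>"
  shows "jacobi_sum A B * jacobi_sum (\<lambda>x. inverse (A x)) (\<lambda>x. inverse (B x)) = of_nat CARD('a)"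
proof -
  have inner: "(\<Sum>y\<in>UNIV. B (1 - t * y) * inverse (B (1 - y))) =
      (if t = 1 then of_nat CARD('a) else 0) - B t" for t
  proof (cases "t = 1")
    case True
    have "(\<Sum>y\<in>UNIV. B (1 - t * y) * inverse (B (1 - y))) = (\<Sum>y\<in>UNIV. if y = (1::'a) then 0 else 1)"
      using True by (intro sum.cong) (auto simp: char_simps[OF B(1)])
    also have "\<dots> = (\<Sum>y\<in>UNIV. 1 - (if y = (1::'a) then 1 else 0))"
      by (intro sum.cong) auto
    also have "\<dots> = of_nat CARD('a) - 1"
      by (simp add: sum_subtractf)
    finally show ?thesis
      using True by (simp add: char_1[OF B(1)])
  next
    case False
    have "(\<Sum>y\<in>UNIV. B (1 - t * y) * inverse (B (1 - y))) =
        (\<Sum>y\<in>UNIV - {1}. B (1 - t * y) * inverse (B (1 - y)))"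
      by (simp add: sum_remove char_0[OF B(1)])
    \<comment> \<open>With \<open>s = 1 / (1 - y)\<close> the quotient of 1 - t y by 1 - y is affine
      in s. The value s = 0 is not attained and accounts for the term B(t).\<close>
    also have "\<dots> = (\<Sum>s\<in>UNIV - {0}. B ((1 - t) * s + t))"
    proof (rule sum.reindex_bij_witness[of _ "\<lambda>s. 1 - 1 / s" "\<lambda>y. 1 / (1 - y)"])
      fix y :: 'a assume "y \<in> UNIV - {1}"
      then have "(1 - t) * (1 / (1 - y)) + t = (1 - t * y) / (1 - y)"
        by (simp add: field_simps)
      then show "B ((1 - t) * (1 / (1 - y)) + t) = B (1 - t * y) * inverse (B (1 - y))"
        by (metis char_divide[OF B(1)] divide_inverse)
    qed auto
    also have "\<dots> = - B t"
      using False sum_affine[of "1 - t" B t] by (simp add: sum_remove sum_char[OF B])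
    finally show ?thesis
      using False by simp
  qed
  have AB': "(\<lambda>x. A x * B x) \<in> carrier mult_chars"
    by (rule mult_in_chars) (use A B in auto)
  have "jacobi_sum A B * jacobi_sum (\<lambda>x. inverse (A x)) (\<lambda>x. inverse (B x)) =
      (\<Sum>t\<in>UNIV. A t * ((if t = 1 then of_nat CARD('a) else 0) - B t))"
    unfolding jacobi_sum_times_jacobi_sum_inverse[OF A] inner ..
  also have "\<dots> = (\<Sum>t\<in>UNIV. if t = (1::'a) then of_nat CARD('a) else 0) - (\<Sum>t\<in>UNIV. A t * B t)"
    unfolding sum_subtractf[symmetric]
    by (intro sum.cong) (auto simp: char_1[OF A(1)] algebra_simps)
  also have "\<dots> = of_nat CARD('a)"
    using sum_char[OF AB' AB] by simp
  finally show ?thesis .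
qed

text \<open>The map x / (x - 1) is an involution that fixes 0 and exchanges 1 with infinity. It
  trades the exponent B at 1 for the inverse of AB, the exponent at infinity.\<close>

lemma jacobi_sum_transform:
  fixes A B :: "'a::finite_field \<Rightarrow> complex"
  assumes A: "A \<in> carrier mult_chars" and B: "B \<in> carrier mult_chars"
  shows "jacobi_sum A B = A (-1) * jacobi_sum A (\<lambda>x. inverse (A x * B x))"
proof -
  define m where "m x = (-1) * (x / (1 - x))" for x :: 'a
  have one_minus_m: "1 - m x = 1 / (1 - x)" if "x \<noteq> 1" for x
    using add_divide_distrib[of "1 - x" x "1 - x"] that by (simp add: m_def)
  have m_m: "m (m x) = x" if "x \<noteq> 1" for x
    unfolding m_def[of "m x"] one_minus_m[OF that] using that by (simp add: m_def)
  have m_neq: "m x \<noteq> 1" if "x \<noteq> 1" for x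
    using one_minus_m[OF that] that by auto
  have "jacobi_sum A B = (\<Sum>x\<in>UNIV - {1}. A x * B (1 - x))"
    by (simp add: sum_remove jacobi_sum_def char_0[OF B])
  also have "\<dots> = (\<Sum>y\<in>UNIV - {1}. A (-1) * (A y * inverse (A (1 - y) * B (1 - y))))"
  proof (rule sum.reindex_bij_witness[of _ m m])
    fix x :: 'a assume "x \<in> UNIV - {1}"
    then have x: "x \<noteq> 1" and d: "1 - x \<noteq> 0" by auto
    have "A (m x) = A (-1) * (A x / A (1 - x))"
      unfolding m_def by (simp only: char_mult[OF A] char_divide[OF A])
    then show "A (-1) * (A (m x) * inverse (A (1 - m x) * B (1 - m x))) = A x * B (1 - x)"
      unfolding one_minus_m[OF x] using char_minus_1_sq[OF A] d
      by (simp add: char_divide[OF A] char_divide[OF B] char_1[OF A] char_1[OF B]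
          char_eq_0_iff[OF A] char_eq_0_iff[OF B] mult.assoc[symmetric])
  qed (auto simp: m_m m_neq)
  also have "\<dots> = A (-1) * jacobi_sum A (\<lambda>x. inverse (A x * B x))"
    by (simp add: sum_remove jacobi_sum_def char_0[OF B] sum_distrib_left)
  finally show ?thesis .
qed

text \<open>The inner sum runs over w of (1 - t y)(1 - y), a quadratic with roots 1 and 1/t. Moving
  the roots to 0 and 1 leaves a multiple of J(w,w). At t = 1 the roots coincide and the sum of w^2
  vanishes.\<close>

lemma jacobi_sum_times_inverse_first:
  fixes T w :: "'a::finite_field \<Rightarrow> complex"
  assumes T: "T \<in> carrier mult_chars" "T \<noteq> \<one>\<^bsub>mult_chars\<^esub>"
    and w: "w \<in> carrier mult_chars" "(\<lambda>x. w x ^ 2) \<noteq> \<one>\<^bsub>mult_chars\<^esub>"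
  shows "jacobi_sum T w * jacobi_sum (\<lambda>x. inverse (T x)) w =
    w (-1) * jacobi_sum w w * (\<Sum>t\<in>UNIV. T t * w ((1 - t)\<^sup>2 / t))"
proof -
  have inner: "T t * (\<Sum>y\<in>UNIV. w (1 - t * y) * w (1 - y)) =
      w (-1) * jacobi_sum w w * (T t * w ((1 - t)\<^sup>2 / t))" for t
  proof (cases "t = 0 \<or> t = 1")
    case True
    have "(\<Sum>y\<in>UNIV. w (1 - y) * w (1 - y)) = (\<Sum>y\<in>UNIV. w y ^ 2)"
      using sum_reflect[of "\<lambda>y. w y ^ 2" 1] by (simp add: power2_eq_square)
    also have "\<dots> = 0"
      using sum_char[OF power_in_chars[OF w(1)] w(2)] by simp
    finally show ?thesis
      using True by (auto simp: char_0[OF T(1)] char_0[OF w(1)])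
  next
    case False
    \<comment> \<open>Difference of the roots: \<open>y = ?a * s + 1\<close> takes s = 0 and s = 1
      to y = 1 and y = 1/t.\<close>
    let ?a = "(1 - t) / t"
    have a: "?a \<noteq> 0" using False by simp
    have "(\<Sum>y\<in>UNIV. w (1 - t * y) * w (1 - y)) =
        (\<Sum>s\<in>UNIV. w (1 - t * (?a * s + 1)) * w (1 - (?a * s + 1)))"
      using sum_affine[OF a, of "\<lambda>y. w (1 - t * y) * w (1 - y)" 1] by simp
    also have "\<dots> = (\<Sum>s\<in>UNIV. w (-1) * w ((1 - t)\<^sup>2 / t) * (w s * w (1 - s)))"
    proof (intro sum.cong refl)
      fix s
      have "(1 - t * (?a * s + 1)) * (1 - (?a * s + 1)) = (-1) * ((1 - t)\<^sup>2 / t) * (s * (1 - s))"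
        using False by (simp add: field_simps power2_eq_square)
      then show "w (1 - t * (?a * s + 1)) * w (1 - (?a * s + 1)) =
          w (-1) * w ((1 - t)\<^sup>2 / t) * (w s * w (1 - s))"
        by (metis char_mult[OF w(1)])
    qed
    also have "\<dots> = w (-1) * w ((1 - t)\<^sup>2 / t) * jacobi_sum w w"
      by (simp add: jacobi_sum_def sum_distrib_left)
    finally show ?thesis by simp
  qed
  show ?thesis
    unfolding jacobi_sum_times_jacobi_sum_inverse[OF T] inner by (simp add: sum_distrib_left)
qed

text \<open>The equation s(s - 1) = N has discriminant 4N + 1, so grouping the sum of w(s(s - 1)) by
  N gives the weight 1 + phi(4N + 1); its constant part drops out because w is nontrivial.\<close>

lemma sum_char_quad_char:
  fixes w :: "'a::finite_field \<Rightarrow> complex"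
  assumes two: "(2 :: 'a) \<noteq> 0" and w: "w \<in> carrier mult_chars" "w \<noteq> \<one>\<^bsub>mult_chars\<^esub>"
  shows "(\<Sum>N\<in>UNIV. w N * quad_char (4 * N + 1)) = w (-1) * jacobi_sum w w"
proof -
  note four = four_nonzero[OF two]
  have card: "card {s. s * (s - 1) = N} = card {z. z\<^sup>2 = 4 * N + 1}" for N :: 'a
  proof (rule bij_betw_same_card)
    show "bij_betw (\<lambda>s. 2 * s - 1) {s. s * (s - 1) = N} {z. z\<^sup>2 = 4 * N + 1}"
    proof (rule bij_betw_byWitness[of _ "\<lambda>z. (z + 1) / 2"])
      show "(\<lambda>s. 2 * s - 1) ` {s. s * (s - 1) = N} \<subseteq> {z. z\<^sup>2 = 4 * N + 1}"
      proof -
        have "(2 * s - 1)\<^sup>2 = 4 * (s * (s - 1)) + 1" for s :: 'a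
          by (simp add: power2_eq_square algebra_simps)
        then show ?thesis by auto
      qed
      show "(\<lambda>z. (z + 1) / 2) ` {z. z\<^sup>2 = 4 * N + 1} \<subseteq> {s. s * (s - 1) = N}"
      proof clarify
        fix z :: 'a assume "z\<^sup>2 = 4 * N + 1"
        then have "(z + 1) * (z - 1) = 4 * N"
          by (simp add: power2_eq_square algebra_simps)
        moreover have "(z + 1) / 2 * ((z + 1) / 2 - 1) = (z + 1) * (z - 1) / 4"
          using two four by (simp add: divide_simps)
        ultimately show "(z + 1) / 2 * ((z + 1) / 2 - 1) = N"
          using four by simp
      qed
    qed (use two in \<open>auto simp: add_divide_distrib\<close>)
  qed
  have "w (-1) * jacobi_sum w w = (\<Sum>s\<in>UNIV. w (s * (s - 1)))"
  proof -
    have "w (-1) * (w s * w (1 - s)) = w (s * (s - 1))" for s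
      by (simp only: char_mult[OF w(1), symmetric]) (simp add: algebra_simps)
    then show ?thesis
      by (simp add: jacobi_sum_def sum_distrib_left)
  qed
  also have "\<dots> = (\<Sum>N\<in>UNIV. w N + w N * quad_char (4 * N + 1))"
    unfolding sum_fiber[of w "\<lambda>s. s * (s - 1)"] card card_square_roots[OF two]
    by (simp add: algebra_simps)
  finally show ?thesis
    by (simp add: sum.distrib sum_char[OF w])
qed

section \<open>Cubic characters and cube roots\<close>

lemma cube_root_of_unity_exists:
  fixes w :: "'a::finite_field \<Rightarrow> complex"
  assumes w: "w \<in> carrier mult_chars" "w \<noteq> \<one>\<^bsub>mult_chars\<^esub>" "\<forall>x. x \<noteq> 0 \<longrightarrow> w x ^ 3 = 1"
  shows "\<exists>\<zeta>::'a. \<zeta> ^ 3 = 1 \<and> \<zeta> \<noteq> 1"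
proof (rule ccontr)
  assume no: "\<not> ?thesis"
  have "inj (\<lambda>x::'a. x ^ 3)"
  proof (rule injI)
    fix x y :: 'a assume eq: "x ^ 3 = y ^ 3"
    show "x = y"
    proof (cases "y = 0")
      case False
      then have "(x / y) ^ 3 = 1"
        using eq by (simp add: power_divide)
      with no have "x / y = 1" by blast
      with False show ?thesis by simp
    qed (use eq in auto)
  qed
  then have surj: "surj (\<lambda>x::'a. x ^ 3)"
    by (simp add: finite_UNIV_inj_surj)
  obtain c where c: "c \<noteq> 0" "w c \<noteq> 1"
    using nontrivial_charE[OF w(1,2)] by blast
  obtain d where d: "c = d ^ 3"
    using surj by (auto elim: surjE)
  with c(1) have "d \<noteq> 0" by auto
  then have "w c = 1"
    using w(3) by (simp add: d char_power[OF w(1)])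
  with c(2) show False by simp
qed

text \<open>The cubic analogue of \<open>card_square_roots\<close>: the right side is the sum of the
  characters of the group generated by w, which detects cubes.\<close>

lemma card_cube_roots:
  fixes w :: "'a::finite_field \<Rightarrow> complex"
  assumes w: "w \<in> carrier mult_chars" "w \<noteq> \<one>\<^bsub>mult_chars\<^esub>" "\<forall>x. x \<noteq> 0 \<longrightarrow> w x ^ 3 = 1"
  shows "of_nat (card {u. u ^ 3 = A}) = 1 + w A + w A ^ 2"
proof -
  consider "A = 0" | "A \<noteq> 0" "\<exists>c. A = c ^ 3" | "A \<noteq> 0" "\<nexists>c. A = c ^ 3" by blast
  then show ?thesis
  proof cases
    case 1
    then show ?thesis by (simp add: char_0[OF w(1)])
  next
    case 2
    then obtain c where c: "A = c ^ 3" "c \<noteq> 0" by auto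
    obtain \<zeta> :: 'a where \<zeta>: "\<zeta> ^ 3 = 1" "\<zeta> \<noteq> 1"
      using cube_root_of_unity_exists[OF w] by blast
    have factor: "x ^ 3 - 1 = (x - 1) * (x\<^sup>2 + x + 1)" for x :: 'a
      by (simp add: algebra_simps power2_eq_square power3_eq_cube)
    have \<zeta>2: "\<zeta>\<^sup>2 + \<zeta> + 1 = 0"
      using factor[of \<zeta>] \<zeta> by simp
    then have \<zeta>2': "\<zeta>\<^sup>2 = - 1 - \<zeta>"
      by (simp add: eq_neg_iff_add_eq_0 algebra_simps)
    have nz: "\<zeta> \<noteq> 0"
      using \<zeta> by auto
    have dist: "\<zeta>\<^sup>2 \<noteq> 1" "\<zeta>\<^sup>2 \<noteq> \<zeta>"
      using \<zeta> nz by (auto simp: power2_eq_square power3_eq_cube)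
    have "{u. u ^ 3 = A} = {c, \<zeta> * c, \<zeta>\<^sup>2 * c}"
    proof (intro equalityI subsetI)
      fix u assume "u \<in> {u. u ^ 3 = A}"
      then have "u ^ 3 = A" by simp
      have "(u / c) ^ 3 - 1 = (u / c - 1) * (u / c - \<zeta>) * (u / c - \<zeta>\<^sup>2)"
        unfolding factor mult.assoc using \<zeta>2
        by (simp add: \<zeta>2') (simp add: algebra_simps \<zeta>2' flip: power2_eq_square)
      moreover have "(u / c) ^ 3 = 1"
        using \<open>u ^ 3 = A\<close> c by (simp add: power_divide)
      ultimately have "u / c = 1 \<or> u / c = \<zeta> \<or> u / c = \<zeta>\<^sup>2"
        by simp
      then show "u \<in> {c, \<zeta> * c, \<zeta>\<^sup>2 * c}"
        using c by (auto simp: divide_eq_eq)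
    next
      have "(\<zeta>\<^sup>2) ^ 3 = (\<zeta> ^ 3)\<^sup>2"
        by (simp flip: power_mult)
      then show "u \<in> {u. u ^ 3 = A}" if "u \<in> {c, \<zeta> * c, \<zeta>\<^sup>2 * c}" for u
        using that \<zeta> c by (auto simp: power_mult_distrib)
    qed
    moreover have "card {c, \<zeta> * c, \<zeta>\<^sup>2 * c} = 3"
      using \<zeta> c dist by (auto simp: card_insert_if)
    moreover have "w A = 1"
      using c w(3) by (simp add: char_power[OF w(1)])
    ultimately show ?thesis by simp
  next
    case 3
    obtain g :: 'a where g: "g \<noteq> 0" "\<And>x. x \<noteq> 0 \<Longrightarrow> \<exists>i::nat. x = g ^ i"
      using generator_exists by blast
    obtain i where i: "A = g ^ i"
      using g(2)[OF 3(1)] by blast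
    \<comment> \<open>A nontrivial character cannot be 1 at a generator, so \<open>w g\<close> is a
      primitive cube root of unity. Exponents prime to 3 then make \<open>1 + w + w^2\<close>
      vanish.\<close>
    have "w g \<noteq> 1"
    proof
      assume "w g = 1"
      obtain c where "c \<noteq> 0" "w c \<noteq> 1"
        using nontrivial_charE[OF w(1,2)] by blast
      then show False
        using g(2)[of c] \<open>w g = 1\<close> by (auto simp: char_power[OF w(1)])
    qed
    moreover have cube: "w g ^ 3 = 1"
      using w(3) g(1) by simp
    moreover have "w g ^ 3 - 1 = (w g - 1) * (1 + w g + w g ^ 2)"
      by (simp add: algebra_simps power2_eq_square power3_eq_cube)
    ultimately have sum: "1 + w g + w g ^ 2 = 0"
      by simp
    have "i mod 3 \<noteq> 0"
    proof
      assume "i mod 3 = 0"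
      then obtain j where "i = j * 3" by (auto elim: dvdE)
      then have "A = (g ^ j) ^ 3"
        by (simp add: i power_mult)
      with 3 show False by blast
    qed
    then have "i mod 3 = 1 \<or> i mod 3 = 2" by linarith
    moreover have "w A = w g ^ (i mod 3)"
    proof -
      have "w A = w g ^ (3 * (i div 3) + i mod 3)"
        by (simp add: i char_power[OF w(1)])
      also have "\<dots> = w g ^ (i mod 3)"
        unfolding power_add power_mult cube by simp
      finally show ?thesis .
    qed
    moreover have "(w g ^ 2) ^ 2 = w g"
      using cube by (simp add: power2_eq_square power3_eq_cube mult.assoc)
    ultimately have "1 + w A + w A ^ 2 = 0"
      using sum by (auto simp: algebra_simps)
    moreover have "{u. u ^ 3 = A} = {}"
      using 3 by auto
    ultimately show ?thesis by simp
  qed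
qed

subsection \<open>Sums of cubic polynomials\<close>

text \<open>This is \<open>P T\<close> of the overview.\<close>

definition cubic_char_sum :: "('a::finite_field \<Rightarrow> complex) \<Rightarrow> complex" where
  "cubic_char_sum T = (\<Sum>u\<in>UNIV. T (1 + u ^ 3))"

text \<open>The deviation from q of the number of affine points on
  \<open>w^2 = 4 * n^3 + c^2\<close>. For c nonzero and characteristic other than 2 and 3 it is
  minus the trace of Frobenius of this elliptic curve.\<close>

definition quad_cubic_sum :: "'a::finite_field \<Rightarrow> complex" where
  "quad_cubic_sum c = (\<Sum>n\<in>UNIV. quad_char (4 * n ^ 3 + c\<^sup>2))"

lemma cube_eq_1D:
  fixes z :: "'a::finite_field"
  assumes "CARD('a) mod 3 = 2" and z: "z ^ 3 = 1"
  shows "z = 1"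
proof -
  have "z = z ^ (3 * (CARD('a) div 3) + 2)"
    using finite_field_power_card_eq_same[of z] assms by (metis mult_div_mod_eq)
  also have "\<dots> = z\<^sup>2"
    unfolding power_add power_mult z by simp
  finally have "z = z\<^sup>2" .
  moreover have "z \<noteq> 0"
    using z by auto
  ultimately show ?thesis
    by (simp add: power2_eq_square)
qed

lemma sum_cubes:
  fixes f :: "'a::finite_field \<Rightarrow> complex"
  assumes "CARD('a) mod 3 = 2"
  shows "(\<Sum>n\<in>UNIV. f (n ^ 3)) = sum f UNIV"
proof -
  have "inj (\<lambda>n::'a. n ^ 3)"
  proof (rule injI)
    fix x y :: 'a assume eq: "x ^ 3 = y ^ 3"
    show "x = y"
    proof (cases "y = 0")
      case False
      then have "(x / y) ^ 3 = 1"
        using eq by (simp add: power_divide)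
      then have "x / y = 1"
        by (rule cube_eq_1D[OF assms])
      then show ?thesis
        using False by simp
    qed (use eq in auto)
  qed
  then have "bij (\<lambda>n::'a. n ^ 3)"
    by (simp add: bij_def finite_UNIV_inj_surj)
  then show ?thesis
    by (rule sum.reindex_bij_betw)
qed

lemma sum_quad_char_linear:
  fixes a b :: "'a::finite_field"
  assumes "(2 :: 'a) \<noteq> 0" "a \<noteq> 0"
  shows "(\<Sum>n\<in>UNIV. quad_char (a * n + b)) = 0"
  unfolding sum_affine[OF assms(2)]
  by (rule sum_char[OF quad_char_in_chars quad_char_nontrivial]) (rule assms)+

lemma quad_cubic_sum_eq_0:
  fixes c :: "'a::finite_field"
  assumes "CARD('a) mod 3 = 2" "(2 :: 'a) \<noteq> 0"
  shows "quad_cubic_sum c = 0"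
  unfolding quad_cubic_sum_def sum_cubes[OF assms(1), of "\<lambda>x. quad_char (4 * x + c\<^sup>2)"]
  by (rule sum_quad_char_linear[OF assms(2) four_nonzero[OF assms(2)]])

context
  fixes w :: "'a::finite_field \<Rightarrow> complex"
  assumes w: "w \<in> carrier mult_chars" "w \<noteq> \<one>\<^bsub>mult_chars\<^esub>" "\<forall>x. x \<noteq> 0 \<longrightarrow> w x ^ 3 = 1"
begin

text \<open>Squaring w is inversion, so it exchanges the two cubic characters, and what holds for w
  also holds for its square. At -1 both the cube and the square of the value are 1, which forces the
  value 1.\<close>

lemma cubic_char_square:
  shows "(\<lambda>x. w x ^ 2) \<in> carrier mult_chars" "(\<lambda>x. w x ^ 2) \<noteq> \<one>\<^bsub>mult_chars\<^esub>"
    and "(w x ^ 2) ^ 2 = w x" "inverse (w x) = w x ^ 2" "w (-1) = 1"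
proof -
  show "(\<lambda>x. w x ^ 2) \<in> carrier mult_chars"
    by (rule power_in_chars) (use w in auto)
  have eq: "w x ^ 3 = w x ^ 2 * w x" for x
    by (simp add: power3_eq_cube power2_eq_square)
  show "(\<lambda>x. w x ^ 2) \<noteq> \<one>\<^bsub>mult_chars\<^esub>"
  proof
    assume *: "(\<lambda>x. w x ^ 2) = \<one>\<^bsub>mult_chars\<^esub>"
    obtain c where c: "c \<noteq> 0" "w c \<noteq> 1"
      using nontrivial_charE[OF w(1,2)] by blast
    then have "w c ^ 2 = 1"
      using fun_cong[OF *, of c] by simp
    then show False
      using w(3)[rule_format, OF c(1)] c(2) eq[of c] by simp
  qed
  show "(w x ^ 2) ^ 2 = w x"
  proof (cases "x = 0")
    case False
    have "(w x ^ 2) ^ 2 = w x ^ 3 * w x"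
      by (simp add: power3_eq_cube power2_eq_square)
    then show ?thesis using w(3)[rule_format, OF False] by simp
  qed (simp add: char_0[OF w(1)])
  show "inverse (w x) = w x ^ 2"
  proof (cases "x = 0")
    case False
    then have "w x * w x ^ 2 = 1"
      using w(3)[rule_format, OF False] eq[of x] by (simp add: mult.commute)
    then show ?thesis by (rule inverse_unique)
  qed (simp add: char_0[OF w(1)])
  have "w (-1) ^ 3 = 1"
    using w(3) by simp
  then show "w (-1) = 1"
    using char_minus_1_sq[OF w(1)] by (simp add: power3_eq_cube)
qed

lemma cubic_char_square_power_3: "\<forall>x. x \<noteq> 0 \<longrightarrow> (w x ^ 2) ^ 3 = 1"
  using w(3) by (metis power_mult mult.commute power_one)

lemma sum_cubic_char_quad_char:
  assumes two: "(2 :: 'a) \<noteq> 0" and c: "c \<noteq> 0"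
  shows "(\<Sum>A\<in>UNIV. w A * quad_char (4 * A + c\<^sup>2)) = w (c\<^sup>2) * jacobi_sum w w"
proof -
  note q = quad_char_in_chars[OF two]
  have c2: "c\<^sup>2 \<noteq> 0" using c by simp
  have "(\<Sum>A\<in>UNIV. w A * quad_char (4 * A + c\<^sup>2)) =
      (\<Sum>A\<in>UNIV. w (c\<^sup>2 * A) * quad_char (4 * (c\<^sup>2 * A) + c\<^sup>2))"
    by (rule sum_scale[OF c2, symmetric])
  also have "\<dots> = (\<Sum>A\<in>UNIV. w (c\<^sup>2) * (w A * quad_char (4 * A + 1)))"
  proof (intro sum.cong refl)
    fix A
    have "4 * (c\<^sup>2 * A) + c\<^sup>2 = c\<^sup>2 * (4 * A + 1)"
      by (simp add: algebra_simps)
    then have "quad_char (4 * (c\<^sup>2 * A) + c\<^sup>2) = quad_char (4 * A + 1)"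
      using quad_char_sq[OF c] by (simp only: char_mult[OF q]) simp
    then show "w (c\<^sup>2 * A) * quad_char (4 * (c\<^sup>2 * A) + c\<^sup>2) =
        w (c\<^sup>2) * (w A * quad_char (4 * A + 1))"
      by (simp add: char_mult[OF w(1)])
  qed
  also have "\<dots> = w (c\<^sup>2) * (w (-1) * jacobi_sum w w)"
    unfolding sum_distrib_left[symmetric] sum_char_quad_char[OF two w(1,2)] ..
  finally show ?thesis
    by (simp add: cubic_char_square)
qed

text \<open>Grouping by \<open>A = u^3\<close> produces the weight \<open>1 + w A + w A ^ 2\<close>.
  The constant part contributes 0, and replacing A by -A turns 1 + A into 1 - A without a sign
  because w(-1) = 1.\<close>

lemma cubic_char_sum_eq_jacobi_sum:
  assumes T: "T \<in> carrier mult_chars" "T \<noteq> \<one>\<^bsub>mult_chars\<^esub>"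
  shows "cubic_char_sum T = jacobi_sum T w + jacobi_sum T (\<lambda>x. w x ^ 2)"
proof -
  have shift: "(\<Sum>A\<in>UNIV. T (1 + A)) = 0"
    using sum_affine[of 1 T 1] sum_char[OF T] by (simp add: add.commute)
  have "cubic_char_sum T = (\<Sum>A\<in>UNIV. (1 + w A + w A ^ 2) * T (1 + A))"
    unfolding cubic_char_sum_def sum_fiber[of "\<lambda>A. T (1 + A)" "\<lambda>u. u ^ 3"]
    by (simp add: card_cube_roots[OF w])
  also have "\<dots> = (\<Sum>A\<in>UNIV. w A * T (1 + A)) + (\<Sum>A\<in>UNIV. w A ^ 2 * T (1 + A))"
    using shift by (simp add: algebra_simps sum.distrib)
  also have "(\<Sum>A\<in>UNIV. w A * T (1 + A)) = (\<Sum>A\<in>UNIV. w (-1 * A) * T (1 + -1 * A))"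
    using sum_scale[of "-1" "\<lambda>A. w A * T (1 + A)"] by simp
  also have "\<dots> = jacobi_sum w T"
    unfolding jacobi_sum_def char_mult[OF w(1)] by (simp add: cubic_char_square)
  also have "(\<Sum>A\<in>UNIV. w A ^ 2 * T (1 + A)) = (\<Sum>A\<in>UNIV. w (-1 * A) ^ 2 * T (1 + -1 * A))"
    using sum_scale[of "-1" "\<lambda>A. w A ^ 2 * T (1 + A)"] by simp
  also have "\<dots> = jacobi_sum (\<lambda>x. w x ^ 2) T"
    unfolding jacobi_sum_def char_mult[OF w(1)] by (simp add: cubic_char_square)
  finally show ?thesis
    by (simp only: jacobi_sum_commute)
qed

end

text \<open>The context is closed and reopened because the results so far are now also applied to the square of \<open>w\<close>.\<close>

context
  fixes w :: "'a::finite_field \<Rightarrow> complex"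
  assumes w: "w \<in> carrier mult_chars" "w \<noteq> \<one>\<^bsub>mult_chars\<^esub>" "\<forall>x. x \<noteq> 0 \<longrightarrow> w x ^ 3 = 1"
begin

lemma quad_cubic_sum_eq_jacobi_sum:
  assumes two: "(2 :: 'a) \<noteq> 0"
  shows "quad_cubic_sum c =
    w (c\<^sup>2) * jacobi_sum w w + w (c\<^sup>2) ^ 2 * jacobi_sum (\<lambda>x. w x ^ 2) (\<lambda>x. w x ^ 2)"
proof (cases "c = 0")
  case True
  note q = quad_char_in_chars[OF two]
  have "quad_char (4 * n ^ 3) = quad_char n" for n :: 'a
  proof (cases "n = 0")
    case False
    have "quad_char (4 * n ^ 3) = quad_char ((2 * n)\<^sup>2 * n)"
      by (simp add: power2_eq_square power3_eq_cube mult_ac)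
    also have "\<dots> = quad_char n"
      using quad_char_sq[of "2 * n"] False two by (simp only: char_mult[OF q, of "(2 * n)\<^sup>2"]) simp
    finally show ?thesis .
  qed simp
  then show ?thesis
    using True sum_quad_char_linear[OF two, of 1 0] by (simp add: quad_cubic_sum_def char_0[OF w(1)])
next
  case False
  note sq = cubic_char_square[OF w]
  have "quad_cubic_sum c = (\<Sum>A\<in>UNIV. (1 + w A + w A ^ 2) * quad_char (4 * A + c\<^sup>2))"
    unfolding quad_cubic_sum_def sum_fiber[of "\<lambda>A. quad_char (4 * A + c\<^sup>2)" "\<lambda>u. u ^ 3"]
    by (simp add: card_cube_roots[OF w])
  also have "\<dots> = (\<Sum>A\<in>UNIV. w A * quad_char (4 * A + c\<^sup>2)) + (\<Sum>A\<in>UNIV. w A ^ 2 * quad_char (4 * A + c\<^sup>2))"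
    using sum_quad_char_linear[OF two four_nonzero[OF two]] by (simp add: distrib_right sum.distrib)
  also have "(\<Sum>A\<in>UNIV. w A * quad_char (4 * A + c\<^sup>2)) = w (c\<^sup>2) * jacobi_sum w w"
    by (rule sum_cubic_char_quad_char[OF w two False])
  also have "(\<Sum>A\<in>UNIV. w A ^ 2 * quad_char (4 * A + c\<^sup>2)) =
      w (c\<^sup>2) ^ 2 * jacobi_sum (\<lambda>x. w x ^ 2) (\<lambda>x. w x ^ 2)"
    by (rule sum_cubic_char_quad_char[OF sq(1,2) cubic_char_square_power_3[OF w] two False])
  finally show ?thesis .
qed

text \<open>Four products arise. The two that pair w with its inverse are equal to q each. The two
  that use the same cubic character on both sides yield J(w,w) and its conjugate weighted over t,
  and together these are the genus-one sums.\<close>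

lemma cubic_char_sum_times_inverse:
  fixes T :: "'a \<Rightarrow> complex"
  assumes two: "(2 :: 'a) \<noteq> 0"
    and T: "T \<in> carrier mult_chars" "T \<noteq> \<one>\<^bsub>mult_chars\<^esub>" "(\<lambda>x. T x ^ 3) \<noteq> \<one>\<^bsub>mult_chars\<^esub>"
  shows "cubic_char_sum T * cubic_char_sum (\<lambda>x. inverse (T x)) =
    2 * of_nat CARD('a) + (\<Sum>t\<in>UNIV. T t * quad_cubic_sum (t * (1 - t)))"
proof -
  let ?T' = "\<lambda>x. inverse (T x)" and ?w' = "\<lambda>x. w x ^ 2"
  note sq = cubic_char_square[OF w]
  have inv_w: "(\<lambda>x. inverse (w x)) = ?w'" and inv_w': "(\<lambda>x. inverse (w x ^ 2)) = w"
    using sq(4) sq(3) by (auto simp flip: sq(4))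
  have T': "?T' \<in> carrier mult_chars" "?T' \<noteq> \<one>\<^bsub>mult_chars\<^esub>"
  proof -
    show "?T' \<in> carrier mult_chars" by (rule inverse_in_chars[OF T(1)])
    obtain c where "c \<noteq> 0" "T c \<noteq> 1"
      using nontrivial_charE[OF T(1,2)] by blast
    then show "?T' \<noteq> \<one>\<^bsub>mult_chars\<^esub>"
      by (metis inverse_eq_1_iff mult_chars_simps(2))
  qed
  obtain c where c: "c \<noteq> 0" "T c ^ 3 \<noteq> 1"
    using nontrivial_charE[OF power_in_chars[OF T(1)] T(3)] by auto
  have Tw: "(\<lambda>x. T x * w x) \<noteq> \<one>\<^bsub>mult_chars\<^esub>"
  proof
    assume "(\<lambda>x. T x * w x) = \<one>\<^bsub>mult_chars\<^esub>"
    from fun_cong[OF this, of c] have "(T c * w c) ^ 3 = 1"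
      using c by simp
    then show False
      using c w(3) by (simp add: power_mult_distrib)
  qed
  have Tw': "(\<lambda>x. T x * w x ^ 2) \<noteq> \<one>\<^bsub>mult_chars\<^esub>"
  proof
    assume "(\<lambda>x. T x * w x ^ 2) = \<one>\<^bsub>mult_chars\<^esub>"
    from fun_cong[OF this, of c] have "(T c * w c ^ 2) ^ 3 = 1"
      using c by simp
    then show False
      using c cubic_char_square_power_3[OF w] by (simp add: power_mult_distrib)
  qed
  have cross1: "jacobi_sum T w * jacobi_sum ?T' ?w' = of_nat CARD('a)"
    using jacobi_sum_times_inverse[OF T(1,2) w(1,2) Tw] unfolding inv_w .
  have cross2: "jacobi_sum T ?w' * jacobi_sum ?T' w = of_nat CARD('a)"
    using jacobi_sum_times_inverse[OF T(1,2) sq(1,2) Tw'] unfolding inv_w' .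
  \<comment> \<open>Origin of the argument t(1 - t): multiplying by the cube t^3 changes nothing
    under w.\<close>
  have arg: "w ((1 - t)\<^sup>2 / t) = w ((t * (1 - t))\<^sup>2)" for t
  proof (cases "t = 0")
    case False
    then have "(t * (1 - t))\<^sup>2 = t ^ 3 * ((1 - t)\<^sup>2 / t)"
      by (simp add: power2_eq_square power3_eq_cube)
    then show ?thesis
      using w(3)[rule_format, OF False] by (simp only: char_mult[OF w(1)] char_power[OF w(1)]) simp
  qed simp
  have d1: "jacobi_sum T w * jacobi_sum ?T' w =
      (\<Sum>t\<in>UNIV. T t * (w ((t * (1 - t))\<^sup>2) * jacobi_sum w w))"
    using jacobi_sum_times_inverse_first[OF T(1,2) w(1) sq(2)]
    by (simp add: sq arg sum_distrib_left mult_ac)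
  have sq_nt: "(\<lambda>x::'a. (w x ^ 2) ^ 2) \<noteq> \<one>\<^bsub>mult_chars\<^esub>"
    using w(2) by (simp only: sq(3)) simp
  have d2: "jacobi_sum T ?w' * jacobi_sum ?T' ?w' =
      (\<Sum>t\<in>UNIV. T t * (w ((t * (1 - t))\<^sup>2) ^ 2 * jacobi_sum ?w' ?w'))"
    unfolding jacobi_sum_times_inverse_first[OF T(1,2) sq(1) sq_nt]
    by (simp add: sq arg sum_distrib_left mult_ac)
  have "cubic_char_sum T * cubic_char_sum ?T' =
      jacobi_sum T w * jacobi_sum ?T' w + jacobi_sum T w * jacobi_sum ?T' ?w' +
      (jacobi_sum T ?w' * jacobi_sum ?T' w + jacobi_sum T ?w' * jacobi_sum ?T' ?w')"
    unfolding cubic_char_sum_eq_jacobi_sum[OF w T(1,2)] cubic_char_sum_eq_jacobi_sum[OF w T']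
    by (simp only: distrib_left distrib_right add_ac)
  also have "\<dots> = 2 * of_nat CARD('a) + (\<Sum>t\<in>UNIV. T t * quad_cubic_sum (t * (1 - t)))"
    unfolding cross1 cross2 d1 d2 quad_cubic_sum_eq_jacobi_sum[OF two]
    by (simp add: distrib_left sum.distrib)
  finally show ?thesis .
qed

end

section \<open>The Hasse--Davenport relation for the prime 3, via the group algebra\<close>

text \<open>The norm form of the group algebra of the cyclic group of order 3.\<close>
definition circulant_norm :: "'a::comm_ring_1 \<Rightarrow> 'a \<Rightarrow> 'a \<Rightarrow> 'a" where
  "circulant_norm p r s = p ^ 3 + r ^ 3 + s ^ 3 - 3 * p * r * s"

text \<open>Multiplicativity of the norm for the product of 1 + u e and (1 - u s) + r e + s e^2 with
  e^3 = 1. The coefficient 1 - u s is what makes the constant term of the product equal to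
  1.\<close>

lemma circulant_norm_mult:
  "(1 + u ^ 3) * circulant_norm (1 - u * s) r s = circulant_norm 1 (r + u - u\<^sup>2 * s) (s + u * r)"
  by (simp add: circulant_norm_def power2_eq_square power3_eq_cube algebra_simps)

lemma sum_circulant_norm_singular:
  fixes T :: "'a::finite_field \<Rightarrow> complex"
  assumes three: "(3 :: 'a) \<noteq> 0" and T: "T \<in> carrier mult_chars" "T \<noteq> \<one>\<^bsub>mult_chars\<^esub>"
    and u: "1 + u ^ 3 = 0"
  shows "(\<Sum>s\<in>UNIV. \<Sum>r\<in>UNIV. T (circulant_norm (1 - u * s) r s)) = 0"
proof -
  define v where "v = - u"
  have v: "v ^ 3 = 1"
    using u by (simp add: v_def eq_neg_iff_add_eq_0[symmetric] minus_equation_iff)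
  then have v0: "v \<noteq> 0" by auto
  have norm_v: "circulant_norm (1 - u * (v\<^sup>2 * s)) (v * r) (v\<^sup>2 * s) = circulant_norm (1 + s) r s" for r s
  proof -
    have "u * (v\<^sup>2 * s) = - (v ^ 3 * s)"
      by (simp add: v_def power3_eq_cube power2_eq_square)
    then have 1: "1 - u * (v\<^sup>2 * s) = 1 + s"
      by (simp add: v)
    have "circulant_norm p (v * r) (v\<^sup>2 * s) =
        p ^ 3 + v ^ 3 * r ^ 3 + (v ^ 3)\<^sup>2 * s ^ 3 - 3 * v ^ 3 * p * r * s" for p
      by (simp add: circulant_norm_def power3_eq_cube power2_eq_square mult_ac)
    then show ?thesis
      unfolding 1 by (simp add: v) (simp add: circulant_norm_def)
  qed
  have factor: "circulant_norm (1 + s) (s + d) s = (1 - d + d\<^sup>2) * (3 * s + (1 + d))" for s d :: 'a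
    by (simp add: circulant_norm_def power2_eq_square power3_eq_cube algebra_simps)
  have "(\<Sum>s\<in>UNIV. \<Sum>r\<in>UNIV. T (circulant_norm (1 - u * s) r s)) =
      (\<Sum>s\<in>UNIV. \<Sum>r\<in>UNIV. T (circulant_norm (1 - u * (v\<^sup>2 * s)) r (v\<^sup>2 * s)))"
    by (rule sum_scale[symmetric]) (use v0 in simp)
  also have "\<dots> = (\<Sum>s\<in>UNIV. \<Sum>r\<in>UNIV. T (circulant_norm (1 - u * (v\<^sup>2 * s)) (v * r) (v\<^sup>2 * s)))"
    by (intro sum.cong refl sum_scale[symmetric] v0)
  also have "\<dots> = (\<Sum>s\<in>UNIV. \<Sum>r\<in>UNIV. T (circulant_norm (1 + s) r s))"
    unfolding norm_v ..
  also have "\<dots> = (\<Sum>s\<in>UNIV. \<Sum>d\<in>UNIV. T (circulant_norm (1 + s) (s + d) s))"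
  proof (rule sum.cong[OF refl])
    fix s
    show "(\<Sum>r\<in>UNIV. T (circulant_norm (1 + s) r s)) = (\<Sum>d\<in>UNIV. T (circulant_norm (1 + s) (s + d) s))"
      using sum_affine[of 1 "\<lambda>r. T (circulant_norm (1 + s) r s)" s] by (simp add: add.commute)
  qed
  also have "\<dots> = (\<Sum>d\<in>UNIV. T (1 - d + d\<^sup>2) * (\<Sum>s\<in>UNIV. T (3 * s + (1 + d))))"
    by (subst sum.swap) (simp only: factor char_mult[OF T(1)] sum_distrib_left)
  also have "\<dots> = 0"
    by (simp add: sum_affine[OF three] sum_char[OF T])
  finally show ?thesis .
qed

text \<open>
  This is the multiplication formula of Hasse and Davenport for the prime 3, with Gauss sums
  eliminated. Dividing by the norm \<open>1 + u ^ 3\<close> of \<open>1 + u e\<close> turns the plane \<open>p = 1\<close>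
  in the group algebra into the plane \<open>p + u s = 1\<close>, and for \<open>s \<noteq> 0\<close> summation over \<open>u\<close> removes
  the linear constraint.
\<close>
lemma circulant_norm_sum_times_cubic_char_sum:
  fixes T :: "'a::finite_field \<Rightarrow> complex"
  assumes three: "(3 :: 'a) \<noteq> 0"
    and T: "T \<in> carrier mult_chars" "T \<noteq> \<one>\<^bsub>mult_chars\<^esub>" "(\<lambda>x. T x ^ 3) \<noteq> \<one>\<^bsub>mult_chars\<^esub>"
  shows "(\<Sum>b\<in>UNIV. \<Sum>c\<in>UNIV. T (circulant_norm 1 b c)) * cubic_char_sum (\<lambda>x. inverse (T x)) =
    of_nat CARD('a) * cubic_char_sum T"
proof -
  define H where "H = (\<Sum>b\<in>UNIV. \<Sum>c\<in>UNIV. T (circulant_norm 1 b c))"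
  have "H * inverse (T (1 + u ^ 3)) = (\<Sum>s\<in>UNIV. \<Sum>r\<in>UNIV. T (circulant_norm (1 - u * s) r s))" for u
  proof (cases "1 + u ^ 3 = 0")
    case True
    then show ?thesis
      using sum_circulant_norm_singular[OF three T(1,2)] by (simp add: char_0[OF T(1)])
  next
    case False
    let ?F = "\<lambda>b c. T (circulant_norm 1 b c)"
    \<comment> \<open>Solves for multiplication by 1 + u e in two shears: once b is replaced by r +
      u - u^2 s, the second argument becomes s + u r, as \<open>circulant_norm_mult\<close>
      requires.\<close>
    have "H = (\<Sum>b\<in>UNIV. \<Sum>s\<in>UNIV. ?F b ((1 + u ^ 3) * s + u * (b - u)))"
      unfolding H_def by (intro sum.cong refl sum_affine[OF False, symmetric])
    also have "\<dots> = (\<Sum>s\<in>UNIV. \<Sum>b\<in>UNIV. ?F b ((1 + u ^ 3) * s + u * (b - u)))"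
      by (rule sum.swap)
    also have "\<dots> = (\<Sum>s\<in>UNIV. \<Sum>r\<in>UNIV. ?F (r + u - u\<^sup>2 * s) (s + u * r))"
    proof (rule sum.cong[OF refl])
      fix s
      have "(\<Sum>b\<in>UNIV. ?F b ((1 + u ^ 3) * s + u * (b - u))) =
          (\<Sum>r\<in>UNIV. ?F (r + (u - u\<^sup>2 * s)) ((1 + u ^ 3) * s + u * (r + (u - u\<^sup>2 * s) - u)))"
        using sum_affine[of 1 "\<lambda>b. ?F b ((1 + u ^ 3) * s + u * (b - u))" "u - u\<^sup>2 * s"] by simp
      also have "\<dots> = (\<Sum>r\<in>UNIV. ?F (r + u - u\<^sup>2 * s) (s + u * r))"
      proof (intro sum.cong refl)
        fix r
        have "(1 + u ^ 3) * s + u * (r + (u - u\<^sup>2 * s) - u) = s + u * r"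
          by (simp add: power2_eq_square power3_eq_cube algebra_simps)
        moreover have "r + (u - u\<^sup>2 * s) = r + u - u\<^sup>2 * s"
          by simp
        ultimately show "?F (r + (u - u\<^sup>2 * s)) ((1 + u ^ 3) * s + u * (r + (u - u\<^sup>2 * s) - u)) =
            ?F (r + u - u\<^sup>2 * s) (s + u * r)"
          by (simp only:)
      qed
      finally show "(\<Sum>b\<in>UNIV. ?F b ((1 + u ^ 3) * s + u * (b - u))) =
          (\<Sum>r\<in>UNIV. ?F (r + u - u\<^sup>2 * s) (s + u * r))" .
    qed
    also have "\<dots> = T (1 + u ^ 3) * (\<Sum>s\<in>UNIV. \<Sum>r\<in>UNIV. T (circulant_norm (1 - u * s) r s))"
      unfolding circulant_norm_mult[symmetric] char_mult[OF T(1)] sum_distrib_left ..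
    finally show ?thesis
      using False by (simp add: char_eq_0_iff[OF T(1)])
  qed
  then have "H * cubic_char_sum (\<lambda>x. inverse (T x)) =
      (\<Sum>u\<in>UNIV. \<Sum>s\<in>UNIV. \<Sum>r\<in>UNIV. T (circulant_norm (1 - u * s) r s))"
    by (simp add: cubic_char_sum_def sum_distrib_left)
  also have "\<dots> = (\<Sum>s\<in>UNIV. \<Sum>u\<in>UNIV. \<Sum>r\<in>UNIV. T (circulant_norm (1 - u * s) r s))"
    by (rule sum.swap)
  \<comment> \<open>At s = 0 the norm is 1 + r^3, independent of u. For s nonzero, 1 - u s runs
    freely, and homogeneity of degree 3 extracts \<open>T s ^ 3\<close>, whose sum over s is
    0.\<close>
  also have "\<dots> = (\<Sum>s\<in>UNIV. (if s = (0::'a) then of_nat CARD('a) * cubic_char_sum T else 0) +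
      T s ^ 3 * (\<Sum>p\<in>UNIV. \<Sum>r\<in>UNIV. T (circulant_norm p r 1)))"
  proof (rule sum.cong[OF refl])
    fix s :: 'a
    show "(\<Sum>u\<in>UNIV. \<Sum>r\<in>UNIV. T (circulant_norm (1 - u * s) r s)) =
        (if s = 0 then of_nat CARD('a) * cubic_char_sum T else 0) +
        T s ^ 3 * (\<Sum>p\<in>UNIV. \<Sum>r\<in>UNIV. T (circulant_norm p r 1))"
    proof (cases "s = 0")
      case True
      then show ?thesis
        by (simp add: char_0[OF T(1)] circulant_norm_def cubic_char_sum_def)
    next
      case False
      have norm_scale: "circulant_norm (s * p) (s * r) s = s ^ 3 * circulant_norm p r 1" for p r
        by (simp add: circulant_norm_def power3_eq_cube algebra_simps)
      have "(\<Sum>u\<in>UNIV. \<Sum>r\<in>UNIV. T (circulant_norm (1 - u * s) r s)) =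
          (\<Sum>p\<in>UNIV. \<Sum>r\<in>UNIV. T (circulant_norm p r s))"
        using sum_affine[of "-s" "\<lambda>p. \<Sum>r\<in>UNIV. T (circulant_norm p r s)" 1] False
        by (simp add: mult.commute)
      also have "\<dots> = (\<Sum>p\<in>UNIV. \<Sum>r\<in>UNIV. T (circulant_norm (s * p) r s))"
        by (rule sum_scale[OF False, symmetric])
      also have "\<dots> = (\<Sum>p\<in>UNIV. \<Sum>r\<in>UNIV. T (circulant_norm (s * p) (s * r) s))"
        by (intro sum.cong refl sum_scale[OF False, symmetric])
      also have "\<dots> = T s ^ 3 * (\<Sum>p\<in>UNIV. \<Sum>r\<in>UNIV. T (circulant_norm p r 1))"
        unfolding norm_scale char_mult[OF T(1)] char_power[OF T(1)] sum_distrib_left ..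
      finally show ?thesis
        using False by simp
    qed
  qed
  also have "\<dots> = of_nat CARD('a) * cubic_char_sum T"
    using sum_char[OF power_in_chars[OF T(1)] T(3)]
    by (simp add: sum.distrib flip: sum_distrib_right)
  finally show ?thesis
    unfolding H_def .
qed

subsection \<open>Triple Jacobi sums\<close>

text \<open>A primitive cube root of unity splits the group algebra, so the norm is a product of the
  three linear forms 1 + b + c, 1 + \<zeta> b + \<zeta>^2 c and 1 + \<zeta>^2 b + \<zeta> c, whose
  sum is 3. Taking two of them as coordinates and scaling each form by 3 gives the factor
  T(27).\<close>

lemma circulant_norm_sum_eq:
  fixes T :: "'a::finite_field \<Rightarrow> complex" and \<zeta> :: 'a
  assumes three: "(3 :: 'a) \<noteq> 0" and T: "T \<in> carrier mult_chars"
    and \<zeta>: "\<zeta> ^ 3 = 1" "\<zeta> \<noteq> 1"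
  shows "(\<Sum>b\<in>UNIV. \<Sum>c\<in>UNIV. T (circulant_norm 1 b c)) =
    T 27 * (\<Sum>x\<in>UNIV. \<Sum>y\<in>UNIV. T (x * y * (1 - x - y)))"
proof -
  have "(\<zeta> - 1) * (\<zeta>\<^sup>2 + \<zeta> + 1) = 0"
    using \<zeta>(1) by (simp add: algebra_simps power2_eq_square power3_eq_cube)
  then have \<zeta>2: "\<zeta>\<^sup>2 + \<zeta> + 1 = 0"
    using \<zeta>(2) by simp
  have "\<zeta> \<noteq> 0" using \<zeta> by auto
  then have nz: "\<zeta> - \<zeta>\<^sup>2 \<noteq> 0"
    using \<zeta>(2) by (simp add: power2_eq_square)
  \<comment> \<open>The second linear form after c has been eliminated in favour of the first form
    X; its slope in b is nonzero because \<zeta> is neither 0 nor 1.\<close>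
  let ?Y = "\<lambda>b X. (\<zeta> - \<zeta>\<^sup>2) * b + (1 - \<zeta>\<^sup>2 + \<zeta>\<^sup>2 * X)"
  have factor: "circulant_norm 1 b (X + (- 1 - b)) = X * ?Y b X * (3 - X - ?Y b X)" for b X
  proof -
    define c where "c = X + (- 1 - b)"
    have X: "X = 1 + b + c"
      by (simp add: c_def)
    have Y: "?Y b X = 1 + \<zeta> * b + \<zeta>\<^sup>2 * c"
      by (simp add: X algebra_simps)
    have "3 - X - ?Y b X = 1 + \<zeta>\<^sup>2 * b + \<zeta> * c - (\<zeta>\<^sup>2 + \<zeta> + 1) * (b + c)"
      unfolding Y by (simp add: X algebra_simps)
    then have Z: "3 - X - ?Y b X = 1 + \<zeta>\<^sup>2 * b + \<zeta> * c"
      by (simp add: \<zeta>2)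
    have "(1 + \<zeta> * b + \<zeta>\<^sup>2 * c) * (1 + \<zeta>\<^sup>2 * b + \<zeta> * c) =
        1 + \<zeta> ^ 3 * (b\<^sup>2 + c\<^sup>2) + (\<zeta>\<^sup>2 + \<zeta> + 1) * (b + c) - (b + c) +
        (\<zeta> ^ 3 * \<zeta> - \<zeta> + (\<zeta>\<^sup>2 + \<zeta> + 1)) * (b * c) - b * c"
      by (simp add: power2_eq_square power3_eq_cube algebra_simps)
    then have "?Y b X * (3 - X - ?Y b X) = 1 + b\<^sup>2 + c\<^sup>2 - (b + c) - b * c"
      unfolding Z unfolding Y by (simp only: \<zeta> \<zeta>2) simp
    moreover have "circulant_norm 1 b c = X * (1 + b\<^sup>2 + c\<^sup>2 - (b + c) - b * c)"
      by (simp add: X circulant_norm_def power2_eq_square power3_eq_cube algebra_simps)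
    ultimately show ?thesis
      unfolding c_def[symmetric] mult.assoc by (simp only:)
  qed
  have scale: "3 * x * (3 * y) * (3 - 3 * x - 3 * y) = 27 * (x * y * (1 - x - y))" for x y :: 'a
    by (simp add: algebra_simps)
  have "(\<Sum>b\<in>UNIV. \<Sum>c\<in>UNIV. T (circulant_norm 1 b c)) =
      (\<Sum>b\<in>UNIV. \<Sum>X\<in>UNIV. T (circulant_norm 1 b (X + (- 1 - b))))"
    using sum_affine[of 1 "\<lambda>c. T (circulant_norm 1 b c)" "- 1 - b" for b] by simp
  also have "\<dots> = (\<Sum>X\<in>UNIV. \<Sum>b\<in>UNIV. T (X * ?Y b X * (3 - X - ?Y b X)))"
    unfolding factor by (rule sum.swap)
  also have "\<dots> = (\<Sum>X\<in>UNIV. \<Sum>Y\<in>UNIV. T (X * Y * (3 - X - Y)))"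
    using sum_affine[OF nz, of "\<lambda>Y. T (X * Y * (3 - X - Y))" "1 - \<zeta>\<^sup>2 + \<zeta>\<^sup>2 * X" for X] by simp
  also have "\<dots> = (\<Sum>X\<in>UNIV. \<Sum>y\<in>UNIV. T (X * (3 * y) * (3 - X - 3 * y)))"
    using sum_scale[OF three, of "\<lambda>Y. T (X * Y * (3 - X - Y))" for X] by simp
  also have "\<dots> = (\<Sum>x\<in>UNIV. \<Sum>y\<in>UNIV. T (3 * x * (3 * y) * (3 - 3 * x - 3 * y)))"
    by (rule sum_scale[OF three, symmetric])
  also have "\<dots> = T 27 * (\<Sum>x\<in>UNIV. \<Sum>y\<in>UNIV. T (x * y * (1 - x - y)))"
    unfolding scale char_mult[OF T, of 27] sum_distrib_left ..
  finally show ?thesis .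
qed

text \<open>Scaling y by 1 - x separates the variables. At x = 1 this is impossible, and that slice
  is the extra term; it vanishes unless T^2 is trivial.\<close>

lemma triple_jacobi_sum:
  fixes T :: "'a::finite_field \<Rightarrow> complex"
  assumes T: "T \<in> carrier mult_chars"
  shows "(\<Sum>x\<in>UNIV. \<Sum>y\<in>UNIV. T (x * y * (1 - x - y))) =
    jacobi_sum T T * jacobi_sum T (\<lambda>x. T x ^ 2) + T (-1) * (\<Sum>x\<in>UNIV. T x ^ 2)"
proof -
  have inner: "(\<Sum>y\<in>UNIV. T (x * y * (1 - x - y))) =
      jacobi_sum T T * (T x * T (1 - x) ^ 2) + (if x = 1 then T (-1) * (\<Sum>x\<in>UNIV. T x ^ 2) else 0)" for x
  proof (cases "x = 1")
    case True
    have "(\<Sum>y\<in>UNIV. T (x * y * (1 - x - y))) = (\<Sum>y\<in>UNIV. T (-1 * (y * y)))"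
      using True by simp
    also have "\<dots> = T (-1) * (\<Sum>x\<in>UNIV. T x ^ 2)"
      unfolding char_mult[OF T] sum_distrib_left power2_eq_square ..
    finally show ?thesis
      using True by (simp add: char_0[OF T])
  next
    case False
    then have nz: "1 - x \<noteq> 0" by simp
    have eq: "x * ((1 - x) * y) * (1 - x - (1 - x) * y) = (x * (1 - x)\<^sup>2) * (y * (1 - y))" for y
      by (simp add: power2_eq_square algebra_simps)
    have "(\<Sum>y\<in>UNIV. T (x * y * (1 - x - y))) =
        (\<Sum>y\<in>UNIV. T (x * ((1 - x) * y) * (1 - x - (1 - x) * y)))"
      by (rule sum_scale[OF nz, symmetric])
    also have "\<dots> = jacobi_sum T T * (T x * T (1 - x) ^ 2)"
      unfolding eq jacobi_sum_def char_mult[OF T] char_power[OF T]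
      by (simp add: sum_distrib_left mult_ac)
    finally show ?thesis
      using False by simp
  qed
  show ?thesis
    unfolding inner by (simp add: sum.distrib jacobi_sum_def[of T "\<lambda>x. T x ^ 2"] sum_distrib_left)
qed

text \<open>The sum \<open>J\<close> is, up to the sign T(-1), the Jacobi sum of the inverses of T
  and T^2, hence the partner of the factor J(T, T^2) of the triple sum. When T^2 is trivial the
  product formula for that pair fails, and the slice x = 1 makes up for it.\<close>

lemma triple_jacobi_sum_times_jacobi_sum:
  fixes T :: "'a::finite_field \<Rightarrow> complex"
  defines "J \<equiv> jacobi_sum (\<lambda>x. T x ^ 3) (\<lambda>x. inverse (T x))"
  assumes T: "T \<in> carrier mult_chars" "T \<noteq> \<one>\<^bsub>mult_chars\<^esub>" "(\<lambda>x. T x ^ 3) \<noteq> \<one>\<^bsub>mult_chars\<^esub>"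
  shows "T (-1) * J * (\<Sum>x\<in>UNIV. \<Sum>y\<in>UNIV. T (x * y * (1 - x - y))) = of_nat CARD('a) * jacobi_sum T T"
    and "J \<noteq> 0"
proof -
  have q0: "(of_nat CARD('a) :: complex) \<noteq> 0"
    by simp
  have T1: "T (-1) * T (-1) = 1"
    by (rule char_minus_1_sq[OF T(1)])
  note T2 = power_in_chars[OF T(1), of 2, simplified]
  have *: "T (-1) * J * (\<Sum>x\<in>UNIV. \<Sum>y\<in>UNIV. T (x * y * (1 - x - y))) = of_nat CARD('a) * jacobi_sum T T \<and>
      J \<noteq> 0"
  proof (cases "(\<lambda>x. T x ^ 2) = \<one>\<^bsub>mult_chars\<^esub>")
    case False
    have "J = jacobi_sum (\<lambda>x. inverse (T x)) (\<lambda>x. T x ^ 3)"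
      unfolding J_def by (rule jacobi_sum_commute)
    also have "\<dots> = T (-1) * jacobi_sum (\<lambda>x. inverse (T x)) (\<lambda>x. inverse (inverse (T x) * T x ^ 3))"
      using jacobi_sum_transform[OF inverse_in_chars[OF T(1)] power_in_chars[OF T(1), of 3]]
        inverse_unique[OF T1] by simp
    also have "(\<lambda>x. inverse (inverse (T x) * T x ^ 3)) = (\<lambda>x. inverse (T x ^ 2))"
    proof
      fix x
      show "inverse (inverse (T x) * T x ^ 3) = inverse (T x ^ 2)"
        by (cases "T x = 0") (auto simp: power2_eq_square power3_eq_cube)
    qed
    finally have J: "J = T (-1) * jacobi_sum (\<lambda>x. inverse (T x)) (\<lambda>x. inverse (T x ^ 2))" .
    have "(\<lambda>x. T x * T x ^ 2) \<noteq> \<one>\<^bsub>mult_chars\<^esub>"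
      using T(3) by (simp add: power3_eq_cube power2_eq_square mult.assoc)
    from jacobi_sum_times_inverse[OF T(1,2) T2 False this]
    have prod: "jacobi_sum T (\<lambda>x. T x ^ 2) * J = T (-1) * of_nat CARD('a)"
      unfolding J by simp
    moreover have "T (-1) \<noteq> 0"
      using T1 by auto
    ultimately have "J \<noteq> 0"
      using q0 by auto
    moreover have "T (-1) * J * (jacobi_sum T T * jacobi_sum T (\<lambda>x. T x ^ 2)) =
        T (-1) * (jacobi_sum T (\<lambda>x. T x ^ 2) * J) * jacobi_sum T T"
      by (simp add: mult_ac)
    ultimately show ?thesis
      unfolding triple_jacobi_sum[OF T(1)] sum_char[OF T2 False] prod
      using T1 by (simp add: mult.assoc[symmetric])
  next
    case True
    \<comment> \<open>T has order 2: J(T,T) and \<open>J\<close> are both -T(-1), and the triple sum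
      is T(-1) + T(-1)(q - 1) = q T(-1).\<close>
    have sq: "T x ^ 2 = (if x = 0 then 0 else 1)" for x
      using fun_cong[OF True, of x] by simp
    have inv: "inverse (T x) = T x" for x
    proof (cases "x = 0")
      case False
      then show ?thesis
        using sq[of x] by (intro inverse_unique) (simp add: power2_eq_square)
    qed (simp add: char_0[OF T(1)])
    have cube: "T x ^ 3 = T x" for x
      using sq[of x] by (simp add: power2_eq_square power3_eq_cube split: if_splits)
    have one: "jacobi_sum T (\<lambda>x. if x = 0 then 0 else 1) = -1"
    proof -
      have "jacobi_sum T (\<lambda>x. if x = 0 then 0 else 1) = (\<Sum>x\<in>UNIV. T x - (if x = 1 then 1 else 0))"
        unfolding jacobi_sum_def by (intro sum.cong) (auto simp: char_1[OF T(1)])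
      then show ?thesis
        by (simp add: sum_subtractf sum_char[OF T(1,2)])
    qed
    have card: "(\<Sum>x\<in>UNIV. T x ^ 2) = of_nat CARD('a) - 1"
    proof -
      have "(\<Sum>x\<in>UNIV. T x ^ 2) = (\<Sum>x\<in>(UNIV::'a set). 1 - (if x = 0 then 1 else 0))"
        by (intro sum.cong) (auto simp: sq)
      then show ?thesis
        by (simp add: sum_subtractf)
    qed
    have JTT: "jacobi_sum T T = - T (-1)"
    proof -
      have "(\<lambda>x. inverse (T x * T x)) = (\<lambda>x. if x = 0 then 0 else 1)"
        using sq by (auto simp: fun_eq_iff power2_eq_square)
      then show ?thesis
        using jacobi_sum_transform[OF T(1) T(1)] one by simp
    qed
    have J: "J = - T (-1)"
      unfolding J_def cube inv JTT ..
    show ?thesis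
      unfolding triple_jacobi_sum[OF T(1)] card J JTT using T1 q0
      by (auto simp: sq one algebra_simps)
  qed
  then show "T (-1) * J * (\<Sum>x\<in>UNIV. \<Sum>y\<in>UNIV. T (x * y * (1 - x - y))) = of_nat CARD('a) * jacobi_sum T T"
    and "J \<noteq> 0" by auto
qed

text \<open>Replaces the sum for T by a multiple of the sum for its inverse, which turns the product
  of the two into the square in the theorem. The 27 comes from the scaling of the linear forms, the
  sign from the transformation of Jacobi sums.\<close>

lemma jacobi_sum_ratio_times_cubic_char_sum:
  fixes T :: "'a::finite_field \<Rightarrow> complex" and \<zeta> :: 'a
  assumes three: "(3 :: 'a) \<noteq> 0" and \<zeta>: "\<zeta> ^ 3 = 1" "\<zeta> \<noteq> 1"
    and T: "T \<in> carrier mult_chars" "T \<noteq> \<one>\<^bsub>mult_chars\<^esub>" "(\<lambda>x. T x ^ 3) \<noteq> \<one>\<^bsub>mult_chars\<^esub>"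
  shows "T (-27) * jacobi_sum T T / jacobi_sum (\<lambda>x. T x ^ 3) (\<lambda>x. inverse (T x)) *
      cubic_char_sum (\<lambda>x. inverse (T x)) = cubic_char_sum T"
proof -
  let ?H = "\<Sum>x\<in>UNIV. \<Sum>y\<in>UNIV. T (x * y * (1 - x - y))"
  let ?J = "jacobi_sum (\<lambda>x. T x ^ 3) (\<lambda>x. inverse (T x))" and ?q = "of_nat CARD('a) :: complex"
  have q0: "?q \<noteq> 0" by simp
  have HD: "T 27 * ?H * cubic_char_sum (\<lambda>x. inverse (T x)) = ?q * cubic_char_sum T"
    using circulant_norm_sum_times_cubic_char_sum[OF three T]
    unfolding circulant_norm_sum_eq[OF three T(1) \<zeta>] .
  have T27: "T (-27) = T (-1) * T 27"
    using char_mult[OF T(1), of "-1" 27] by simp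
  have "?q * (T (-27) * jacobi_sum T T / ?J * cubic_char_sum (\<lambda>x. inverse (T x))) =
      T (-1) * T 27 * (?q * jacobi_sum T T) / ?J * cubic_char_sum (\<lambda>x. inverse (T x))"
    by (simp add: T27)
  also have "\<dots> = (T (-1) * T (-1)) * (T 27 * ?H * cubic_char_sum (\<lambda>x. inverse (T x)))"
    unfolding triple_jacobi_sum_times_jacobi_sum(1)[OF T, symmetric]
    using triple_jacobi_sum_times_jacobi_sum(2)[OF T] by (simp add: mult_ac)
  also have "\<dots> = ?q * cubic_char_sum T"
    unfolding HD char_minus_1_sq[OF T(1)] by simp
  finally show ?thesis
    by (rule mult_left_cancel[OF q0, THEN iffD1])
qed

subsection \<open>The quartic curves\<close>

text \<open>Up to square factors this is the argument of the quadratic character on the parametrized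
  cubic. Its coefficients make the first invariant 12ae - 3bd + c^2 vanish, and at t = 1 it
  degenerates to (m - 1)^4.\<close>

definition quartic :: "'a::comm_ring_1 \<Rightarrow> 'a \<Rightarrow> 'a" where
  "quartic t m = m ^ 4 - 4 * t * m ^ 3 + 6 * t * m\<^sup>2 - 4 * t * m + t\<^sup>2"

lemma quartic_eq: "quartic t m = (t - m\<^sup>2)\<^sup>2 - 4 * t * m * (1 - m)\<^sup>2"
  by (simp add: quartic_def power2_eq_square power3_eq_cube power4_eq_xxxx algebra_simps)

lemma card_quadratic_roots:
  fixes A B C :: "'a::finite_field"
  assumes two: "(2 :: 'a) \<noteq> 0"
  shows "of_nat (card {m. A * m\<^sup>2 + 2 * B * m + C = 0}) =
    (if A \<noteq> 0 then 1 + quad_char (B\<^sup>2 - A * C) else if B \<noteq> 0 then 1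
     else if C = 0 then of_nat CARD('a) else 0)"
proof (cases "A = 0")
  case False
  have iff: "A * m\<^sup>2 + 2 * B * m + C = 0 \<longleftrightarrow> (A * m + B)\<^sup>2 = B\<^sup>2 - A * C" for m
  proof -
    have "(A * m + B)\<^sup>2 - (B\<^sup>2 - A * C) = A * (A * m\<^sup>2 + 2 * B * m + C)"
      by (simp add: power2_eq_square algebra_simps)
    then show ?thesis
      using False by (metis eq_iff_diff_eq_0 mult_eq_0_iff)
  qed
  have "bij_betw (\<lambda>m. A * m + B) {m. A * m\<^sup>2 + 2 * B * m + C = 0} {z. z\<^sup>2 = B\<^sup>2 - A * C}"
    by (rule bij_betw_byWitness[of _ "\<lambda>z. (z - B) / A"]) (use False in \<open>auto simp: iff\<close>)
  then have "card {m. A * m\<^sup>2 + 2 * B * m + C = 0} = card {z. z\<^sup>2 = B\<^sup>2 - A * C}"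
    by (rule bij_betw_same_card)
  then show ?thesis
    using False card_square_roots[OF two] by simp
next
  case True
  have "{m. 2 * B * m + C = 0} = {- C / (2 * B)}" if "B \<noteq> 0"
  proof -
    have B: "2 * B \<noteq> 0" using that two by simp
    have "2 * B * m + C = 0 \<longleftrightarrow> m = - C / (2 * B)" for m
      unfolding nonzero_eq_divide_eq[OF B] eq_neg_iff_add_eq_0 by (simp add: mult.commute)
    then show ?thesis by auto
  qed
  then show ?thesis
    using True by auto
qed

text \<open>Ferrari's method used for counting: the points of \<open>w^2 = quartic t m\<close> are
  counted first by m and then by n. The part m^2 - 2 t m matches the two leading terms of the
  quartic, so only a quadratic in m remains for each n.\<close>

lemma sum_quad_char_quartic:
  fixes t :: "'a::finite_field"
  assumes two: "(2 :: 'a) \<noteq> 0" and three: "(3 :: 'a) \<noteq> 0" and t: "t \<noteq> 0"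
  shows "(\<Sum>m\<in>UNIV. quad_char (quartic t m)) =
    (if t = 1 then of_nat CARD('a) else 0) - 1 + quad_cubic_sum (t * (1 - t))"
proof -
  note four = four_nonzero[OF two]
  note q = quad_char_in_chars[OF two]
  define A B C where "A n = 4 * (n + t * (1 - t))" and "B n = 2 * t * (t - 1 - 2 * n)"
    and "C n = 4 * n * (t - n)" for n
  text \<open>
    For \<open>w = m\<^sup>2 - 2 * t * m + k\<close> the equation \<open>w\<^sup>2 = quartic t m\<close> becomes quadratic in \<open>m\<close>.
    Since the first invariant of the quartic vanishes, the discriminant is a cube plus a constant,
    and \<open>k = t - 2 * n\<close> centres the cube at \<open>n = 0\<close>.
  \<close>
  have resolvent: "(m\<^sup>2 - 2 * t * m + (- 2 * n + t))\<^sup>2 = quartic t m \<longleftrightarrow>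
      A n * m\<^sup>2 + 2 * B n * m + C n = 0" for m n
  proof -
    have "quartic t m - (m\<^sup>2 - 2 * t * m + (- 2 * n + t))\<^sup>2 = A n * m\<^sup>2 + 2 * B n * m + C n"
      by (simp add: quartic_def A_def B_def C_def power2_eq_square power3_eq_cube power4_eq_xxxx
          algebra_simps)
    then show ?thesis
      by (metis eq_iff_diff_eq_0)
  qed
  have disc: "(B n)\<^sup>2 - A n * C n = 2\<^sup>2 * (4 * n ^ 3 + (t * (1 - t))\<^sup>2)" for n
    by (simp add: A_def B_def C_def power2_eq_square power3_eq_cube algebra_simps)
  then have quad_disc: "quad_char ((B n)\<^sup>2 - A n * C n) = quad_char (4 * n ^ 3 + (t * (1 - t))\<^sup>2)" for n
    unfolding disc char_mult[OF q, of "2\<^sup>2"] quad_char_sq[OF two] by simp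
  have count: "of_nat (card {m. A n * m\<^sup>2 + 2 * B n * m + C n = 0}) =
      1 + quad_char (4 * n ^ 3 + (t * (1 - t))\<^sup>2) +
      (if n = - (t * (1 - t)) then (if t = 1 then of_nat CARD('a) else 0) - 1 else 0)" for n
  proof (cases "n = - (t * (1 - t))")
    case False
    then have "n + t * (1 - t) \<noteq> 0"
      by (simp add: eq_neg_iff_add_eq_0)
    then have "A n \<noteq> 0"
      unfolding A_def using four by (metis mult_eq_0_iff)
    then show ?thesis
      using False by (simp only: card_quadratic_roots[OF two] quad_disc) simp
  next
    case True
    have A: "A n = 0"
      by (simp add: A_def True)
    have B: "B n = - (2 * t * (2 * t - 1) * (t - 1))"
      by (simp add: B_def True algebra_simps)
    have C: "C n = - (4 * t\<^sup>2 * (1 - t) * (2 - t))"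
      by (simp add: C_def True power2_eq_square algebra_simps)
    have phi: "quad_char (4 * n ^ 3 + (t * (1 - t))\<^sup>2) = quad_char ((B n)\<^sup>2)"
      using quad_disc[of n] by (simp add: A)
    \<comment> \<open>At the one n where the leading coefficient vanishes: generic t leaves a linear
      equation with one root, t = 1 an identity with q roots, and 2t = 1 a nonzero constant with no
      root.\<close>
    consider "t = 1" | "t \<noteq> 1" "2 * t - 1 \<noteq> 0" | "t \<noteq> 1" "2 * t - 1 = 0" by blast
    then show ?thesis
    proof cases
      case 1
      have BC: "B n = 0" "C n = 0"
        using 1 by (simp_all add: B C)
      show ?thesis
        unfolding card_quadratic_roots[OF two] phi A BC using 1 True by simp
    next
      case 2
      then have "B n \<noteq> 0"
        using two t by (simp add: B)
      then have "quad_char ((B n)\<^sup>2) = 1" "B n \<noteq> 0"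
        by (simp_all add: quad_char_sq)
      then show ?thesis
        unfolding card_quadratic_roots[OF two] phi A using 2 True by simp
    next
      case 3
      have "2 - t = 3 * t - 2 * (2 * t - 1)"
        by (simp add: algebra_simps)
      then have "2 - t = 3 * t"
        unfolding 3(2) by simp
      then have "2 - t \<noteq> 0"
        using three t by (metis mult_eq_0_iff)
      then have "C n \<noteq> 0" "B n = 0"
        using 3 four t by (auto simp: B C)
      then show ?thesis
        unfolding card_quadratic_roots[OF two] phi A using 3 True by simp
    qed
  qed
  have card_sum: "of_nat (card {x. P x}) = (\<Sum>x\<in>UNIV. of_bool (P x) :: complex)" for P :: "'a \<Rightarrow> bool"
    by (simp add: sum.If_cases of_bool_def)
  have "of_nat CARD('a) + (\<Sum>m\<in>UNIV. quad_char (quartic t m)) =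
      (\<Sum>m\<in>UNIV. of_nat (card {w. w\<^sup>2 = quartic t m}))"
    by (simp add: card_square_roots[OF two] sum.distrib)
  \<comment> \<open>For fixed m, every w comes from exactly one n because 2 is invertible.\<close>
  also have "\<dots> = (\<Sum>m\<in>UNIV. \<Sum>n\<in>UNIV. of_bool ((m\<^sup>2 - 2 * t * m + (- 2 * n + t))\<^sup>2 = quartic t m))"
  proof (rule sum.cong[OF refl])
    fix m
    have "(\<Sum>w\<in>UNIV. of_bool (w\<^sup>2 = quartic t m) :: complex) =
        (\<Sum>n\<in>UNIV. of_bool ((- 2 * n + (m\<^sup>2 - 2 * t * m + t))\<^sup>2 = quartic t m))"
      by (rule sum_affine[symmetric]) (use two in simp)
    then show "of_nat (card {w. w\<^sup>2 = quartic t m}) =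
        (\<Sum>n\<in>UNIV. of_bool ((m\<^sup>2 - 2 * t * m + (- 2 * n + t))\<^sup>2 = quartic t m) :: complex)"
      unfolding card_sum by (simp add: algebra_simps)
  qed
  also have "\<dots> = (\<Sum>n\<in>UNIV. of_nat (card {m. A n * m\<^sup>2 + 2 * B n * m + C n = 0}))"
    unfolding resolvent card_sum by (rule sum.swap)
  also have "\<dots> = of_nat CARD('a) + quad_cubic_sum (t * (1 - t)) +
      ((if t = 1 then of_nat CARD('a) else 0) - 1)"
    unfolding count by (simp add: sum.distrib quad_cubic_sum_def)
  finally show ?thesis
    by (simp add: algebra_simps)
qed

section \<open>Evaluation of the reduced double sum\<close>

lemma sum_quad_char_product:
  assumes two: "(2 :: 'a::finite_field) \<noteq> 0"
  shows "(\<Sum>x\<in>UNIV. quad_char ((1 - 3 * x) * (1 + x :: 'a))) = - quad_char (-3 :: 'a)"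
proof -
  note q = quad_char_in_chars[OF two]
  have "(\<Sum>x\<in>UNIV. quad_char ((1 - 3 * x) * (1 + x :: 'a))) =
      (\<Sum>s\<in>UNIV. quad_char ((1 - 3 * (s - 1)) * (1 + (s - 1 :: 'a))))"
    using sum_affine[of 1 "\<lambda>x::'a. quad_char ((1 - 3 * x) * (1 + x))" "-1"] by simp
  also have "\<dots> = (\<Sum>s\<in>UNIV - {0}. quad_char ((1 - 3 * (s - 1)) * (1 + (s - 1 :: 'a))))"
    by (simp add: sum_remove)
  \<comment> \<open>With s = 1 + x the product is s(4 - 3s), which is s^2 times 4/s - 3, so r = 1/s
    makes it linear up to a square. The missing r = 0 leaves -phi(-3).\<close>
  also have "\<dots> = (\<Sum>r\<in>UNIV - {0}. quad_char (4 * r + - 3 :: 'a))"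
  proof (rule sum.reindex_bij_witness[of _ inverse inverse])
    fix s :: 'a assume "s \<in> UNIV - {0}"
    then have s: "s \<noteq> 0" by simp
    have "(1 - 3 * (s - 1)) * (1 + (s - 1)) = s\<^sup>2 * (4 * inverse s + - 3)"
      using s by (simp add: power2_eq_square algebra_simps)
    then show "quad_char (4 * inverse s + - 3) = quad_char ((1 - 3 * (s - 1)) * (1 + (s - 1)))"
      by (simp only: char_mult[OF q, of "s\<^sup>2"] quad_char_sq[OF s]) simp
  qed auto
  also have "\<dots> = - quad_char (-3 :: 'a)"
    using sum_quad_char_linear[OF two four_nonzero[OF two], of "-3"] by (simp add: sum_remove)
  finally show ?thesis .
qed

text \<open>What is left of the three Jacobi sums once the third variable is eliminated. For a
  character T, the conventions \<open>x / 0 = 0\<close> and \<open>T 0 = 0\<close> remove all points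
  with a coordinate 0 or 1.\<close>

definition reduced_sum :: "('a::finite_field \<Rightarrow> complex) \<Rightarrow> complex" where
  "reduced_sum T = (\<Sum>(x, y)\<in>UNIV. T (x * (1 - x)\<^sup>2 / (y * (1 - y)\<^sup>2)) *
     quad_char ((1 - x) * (1 - y) * ((1 - x) * (1 - y) - 4 * x * y)))"

text \<open>The diagonal is a component of the curve at t = 1 and corresponds to the single slope m
  = 1, so it is summed separately. The quotient inside T is 1 except at x = 0 and x = 1, where it is
  0 by convention; the values lost there are phi(1) and phi(-4).\<close>

lemma reduced_sum_diagonal:
  fixes T :: "'a::finite_field \<Rightarrow> complex"
  assumes two: "(2 :: 'a) \<noteq> 0" and T: "T \<in> carrier mult_chars"
  shows "(\<Sum>x\<in>UNIV. T (x * (1 - x)\<^sup>2 / (x * (1 - x)\<^sup>2)) *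
      quad_char ((1 - x) * (1 - x) * ((1 - x) * (1 - x) - 4 * x * x))) =
    - quad_char (-3 :: 'a) - 1 - quad_char (-1 :: 'a)"
proof -
  note q = quad_char_in_chars[OF two]
  have m4: "quad_char (-4 :: 'a) = quad_char (-1 :: 'a)"
  proof -
    have "quad_char (-1 * 2\<^sup>2 :: 'a) = quad_char (-1 :: 'a)"
      by (simp only: char_mult[OF q] quad_char_sq[OF two]) simp
    then show ?thesis by simp
  qed
  have term_eq: "T (x * (1 - x)\<^sup>2 / (x * (1 - x)\<^sup>2)) *
      quad_char ((1 - x) * (1 - x) * ((1 - x) * (1 - x) - 4 * x * x)) =
      quad_char ((1 - 3 * x) * (1 + x)) - (if x = 0 then 1 else 0) - (if x = 1 then quad_char (-1 :: 'a) else 0)" for x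
  proof -
    consider "x = 0" | "x = 1" | "x \<noteq> 0" "x \<noteq> 1" by blast
    then show ?thesis
    proof cases
      case 3
      have "(1 - x) * (1 - x) * ((1 - x) * (1 - x) - 4 * x * x) = (1 - x)\<^sup>2 * ((1 - 3 * x) * (1 + x))"
        by (simp add: power2_eq_square algebra_simps)
      moreover have "quad_char ((1 - x)\<^sup>2 * ((1 - 3 * x) * (1 + x))) = quad_char ((1 - 3 * x) * (1 + x))"
        using 3 quad_char_sq[of "1 - x"] by (simp only: char_mult[OF q, of "(1 - x)\<^sup>2"]) simp
      ultimately show ?thesis
        using 3 by (simp add: char_1[OF T])
    qed (simp_all add: char_0[OF T] m4)
  qed
  show ?thesis
    unfolding term_eq by (simp add: sum_subtractf sum_quad_char_product[OF two])
qed

lemma reduced_sum_off_diagonal: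
  fixes T :: "'a::finite_field \<Rightarrow> complex"
  assumes two: "(2 :: 'a) \<noteq> 0" and T: "T \<in> carrier mult_chars"
  shows "(\<Sum>(x, y)\<in>{(x, y). x \<noteq> y}. T (x * (1 - x)\<^sup>2 / (y * (1 - y)\<^sup>2)) *
      quad_char ((1 - x) * (1 - y) * ((1 - x) * (1 - y) - 4 * x * y))) =
    (\<Sum>m\<in>UNIV - {0, 1}. \<Sum>t\<in>UNIV - {m\<^sup>2, m ^ 3}. T t * quad_char (quartic t m))"
proof -
  note q = quad_char_in_chars[OF two]
  let ?F = "\<lambda>x y. T (x * (1 - x)\<^sup>2 / (y * (1 - y)\<^sup>2)) *
      quad_char ((1 - x) * (1 - y) * ((1 - x) * (1 - y) - 4 * x * y))"
  \<comment> \<open>\<open>D\<close> and \<open>E\<close> drop only terms in which T vanishes, so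
    that the two changes of coordinates become honest inverse bijections.\<close>
  define D :: "('a \<times> 'a) set" where
    "D = {(x, y). x \<noteq> y \<and> x \<noteq> 0 \<and> y \<noteq> 0 \<and> x \<noteq> 1 \<and> y \<noteq> 1}"
  define E :: "('a \<times> 'a) set" where
    "E = {(m, t). m \<noteq> 0 \<and> m \<noteq> 1 \<and> t \<noteq> 0 \<and> t \<noteq> m\<^sup>2 \<and> t \<noteq> m ^ 3}"
  define to_m :: "'a \<times> 'a \<Rightarrow> 'a \<times> 'a" where
    "to_m = (\<lambda>(x, y). ((1 - x) / (1 - y), ((1 - x) / (1 - y))\<^sup>2 * x / y))"
  \<comment> \<open>Solution of the linear system m(1 - y) = 1 - x and t y = m^2 x. Its determinant
    vanishes at t = m^3, and t = m^2 would give the node x = y = 1.\<close>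
  define to_x :: "'a \<times> 'a \<Rightarrow> 'a \<times> 'a" where
    "to_x = (\<lambda>(m, t). (t * (1 - m) / (t - m ^ 3), m\<^sup>2 * (1 - m) / (t - m ^ 3)))"
  have D: "to_x (to_m (x, y)) = (x, y) \<and> to_m (x, y) \<in> E" if "(x, y) \<in> D" for x y
  proof -
    from that have xy: "x \<noteq> y" "x \<noteq> 0" "y \<noteq> 0" "1 - x \<noteq> 0" "1 - y \<noteq> 0"
      by (auto simp: D_def)
    define m where "m = (1 - x) / (1 - y)"
    define t where "t = m\<^sup>2 * x / y"
    have m_mult: "m * (1 - y) = 1 - x" and t_mult: "t * y = m\<^sup>2 * x"
      using xy by (simp_all add: m_def t_def)
    have one_m: "(1 - m) * (1 - y) = x - y"
      using m_mult by (simp add: algebra_simps)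
    have m0: "m \<noteq> 0" using xy by (simp add: m_def)
    have m1: "1 - m \<noteq> 0"
      using one_m xy(1) by auto
    have t0: "t \<noteq> 0" using xy m0 by (simp add: t_def)
    have d: "(t - m ^ 3) * y = m\<^sup>2 * (1 - m)"
    proof -
      have "(t - m ^ 3) * y = m\<^sup>2 * (x - m * y)"
        by (simp add: left_diff_distrib t_mult power2_eq_square power3_eq_cube algebra_simps)
      also have "x - m * y = 1 - m"
        using m_mult by (simp add: algebra_simps)
      finally show ?thesis .
    qed
    then have d0: "t - m ^ 3 \<noteq> 0"
      using m0 m1 by auto
    have "(t - m\<^sup>2) * y = m\<^sup>2 * (x - y)"
      by (simp add: left_diff_distrib t_mult right_diff_distrib)
    then have tm2: "t \<noteq> m\<^sup>2"
      using m0 xy(1) by auto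
    have y: "m\<^sup>2 * (1 - m) / (t - m ^ 3) = y"
      unfolding d[symmetric] using d0 by simp
    have "t * (1 - m) / (t - m ^ 3) = t * (m\<^sup>2 * (1 - m) / (t - m ^ 3)) / m\<^sup>2"
      using m0 by simp
    also have "\<dots> = x"
      unfolding y t_mult using m0 by simp
    finally have x: "t * (1 - m) / (t - m ^ 3) = x" .
    have "to_m (x, y) = (m, t)"
      by (simp add: to_m_def m_def t_def)
    then show ?thesis
      using x y m0 m1 t0 tm2 d0 by (simp add: to_x_def E_def)
  qed
  have E: "to_m (to_x (m, t)) = (m, t) \<and> to_x (m, t) \<in> D \<and>
      case_prod ?F (to_x (m, t)) = T t * quad_char (quartic t m)" if "(m, t) \<in> E" for m t
  proof -
    from that have mt: "m \<noteq> 0" "1 - m \<noteq> 0" "t \<noteq> 0" "t - m\<^sup>2 \<noteq> 0" and d0: "t - m ^ 3 \<noteq> 0"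
      by (auto simp: E_def)
    define d where "d = t - m ^ 3"
    define x where "x = t * (1 - m) / d"
    define y where "y = m\<^sup>2 * (1 - m) / d"
    have d: "d \<noteq> 0" using d0 by (simp add: d_def)
    have "d - t * (1 - m) = m * (t - m\<^sup>2)"
      by (simp add: d_def power2_eq_square power3_eq_cube algebra_simps)
    then have one_x: "1 - x = m * (t - m\<^sup>2) / d"
      using diff_divide_distrib[of d "t * (1 - m)" d] d by (simp add: x_def)
    have "d - m\<^sup>2 * (1 - m) = t - m\<^sup>2"
      by (simp add: d_def power2_eq_square power3_eq_cube algebra_simps)
    then have one_y: "1 - y = (t - m\<^sup>2) / d"
      using diff_divide_distrib[of d "m\<^sup>2 * (1 - m)" d] d by (simp add: y_def)
    have m: "(1 - x) / (1 - y) = m"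
      unfolding one_x one_y using mt d by simp
    have xy: "x / y = t / m\<^sup>2"
      unfolding x_def y_def using mt d by simp
    have t: "m\<^sup>2 * x / y = t"
      using mt xy by (metis nonzero_mult_div_cancel_left power_not_zero times_divide_eq_right)
    have neq: "x \<noteq> y"
    proof -
      have "x - y = (t - m\<^sup>2) * (1 - m) / d"
        by (simp add: x_def y_def left_diff_distrib diff_divide_distrib)
      then show ?thesis using mt d by auto
    qed
    have arg: "x * (1 - x)\<^sup>2 / (y * (1 - y)\<^sup>2) = t"
    proof -
      have "x * (1 - x)\<^sup>2 / (y * (1 - y)\<^sup>2) = ((1 - x) / (1 - y))\<^sup>2 * x / y"
        by (simp add: power_divide mult.commute)
      then show ?thesis unfolding m t .
    qed
    have "(1 - x) * (1 - y) * ((1 - x) * (1 - y) - 4 * x * y) =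
        (m * (t - m\<^sup>2)\<^sup>2 / d\<^sup>2) * (m * ((t - m\<^sup>2)\<^sup>2 - 4 * t * m * (1 - m)\<^sup>2) / d\<^sup>2)"
    proof -
      have "(1 - x) * (1 - y) = m * (t - m\<^sup>2)\<^sup>2 / d\<^sup>2"
        unfolding one_x one_y by (simp add: power2_eq_square mult_ac)
      moreover have "4 * x * y = 4 * t * m\<^sup>2 * (1 - m)\<^sup>2 / d\<^sup>2"
        unfolding x_def y_def by (simp add: power2_eq_square mult_ac)
      moreover have "m * (t - m\<^sup>2)\<^sup>2 / d\<^sup>2 - 4 * t * m\<^sup>2 * (1 - m)\<^sup>2 / d\<^sup>2 =
          m * ((t - m\<^sup>2)\<^sup>2 - 4 * t * m * (1 - m)\<^sup>2) / d\<^sup>2"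
        unfolding diff_divide_distrib[symmetric] by (simp add: power2_eq_square algebra_simps)
      ultimately show ?thesis by (simp only:)
    qed
    also have "\<dots> = (m * (t - m\<^sup>2) / d\<^sup>2)\<^sup>2 * quartic t m"
      unfolding quartic_eq by (simp add: power2_eq_square mult_ac)
    finally have "quad_char ((1 - x) * (1 - y) * ((1 - x) * (1 - y) - 4 * x * y)) = quad_char (quartic t m)"
      using quad_char_sq[of "m * (t - m\<^sup>2) / d\<^sup>2"] mt d
      by (simp only: char_mult[OF q, of "(m * (t - m\<^sup>2) / d\<^sup>2)\<^sup>2"]) simp
    moreover have "x \<noteq> 0" "y \<noteq> 0" "x \<noteq> 1" "y \<noteq> 1"
    proof -
      show "x \<noteq> 0" "y \<noteq> 0"
        using mt d by (simp_all add: x_def y_def)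
      have "1 - x \<noteq> 0" "1 - y \<noteq> 0"
        unfolding one_x one_y using mt d by simp_all
      then show "x \<noteq> 1" "y \<noteq> 1" by auto
    qed
    moreover have "to_x (m, t) = (x, y)"
      by (simp add: to_x_def x_def y_def d_def)
    ultimately show ?thesis
      using neq arg m t by (simp add: to_m_def D_def)
  qed
  have "(\<Sum>(x, y)\<in>{(x, y). x \<noteq> y}. ?F x y) = (\<Sum>(x, y)\<in>D. ?F x y)"
    by (rule sum.mono_neutral_right) (auto simp: D_def char_0[OF T])
  also have "\<dots> = (\<Sum>(m, t)\<in>E. T t * quad_char (quartic t m))"
  proof (rule sum.reindex_bij_witness[of _ to_x to_m])
    fix a assume "a \<in> D"
    then show "to_x (to_m a) = a" "to_m a \<in> E"
      using D[of "fst a" "snd a"] by simp_all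
    then show "(case to_m a of (m, t) \<Rightarrow> T t * quad_char (quartic t m)) = (case a of (x, y) \<Rightarrow> ?F x y)"
      using E[of "fst (to_m a)" "snd (to_m a)"] by (simp add: case_prod_beta)
  next
    fix b assume "b \<in> E"
    then show "to_m (to_x b) = b" "to_x b \<in> D"
      using E[of "fst b" "snd b"] by simp_all
  qed
  also have "\<dots> = (\<Sum>(m, t)\<in>(SIGMA m:UNIV - {0, 1}. UNIV - {m\<^sup>2, m ^ 3}). T t * quad_char (quartic t m))"
    by (rule sum.mono_neutral_left) (auto simp: E_def char_0[OF T])
  also have "\<dots> = (\<Sum>m\<in>UNIV - {0, 1}. \<Sum>t\<in>UNIV - {m\<^sup>2, m ^ 3}. T t * quad_char (quartic t m))"
    by (rule sum.Sigma[symmetric]) auto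
  finally show ?thesis .
qed

text \<open>The punctured sum over (m, t) is completed. The line m = 0 contributes 0 and m = 1
  contributes -1, while the curves t = m^2 and t = m^3 carry the characters T^2 phi and T^3 times
  phi(-1) and phi(-3). All these corrections cancel against the diagonal.\<close>

lemma reduced_sum_eq:
  fixes T :: "'a::finite_field \<Rightarrow> complex"
  assumes two: "(2 :: 'a) \<noteq> 0" and three: "(3 :: 'a) \<noteq> 0"
    and T: "T \<in> carrier mult_chars" "T \<noteq> \<one>\<^bsub>mult_chars\<^esub>" "(\<lambda>x. T x ^ 3) \<noteq> \<one>\<^bsub>mult_chars\<^esub>"
    and T2: "(\<lambda>x. T x ^ 2 * quad_char x) \<noteq> \<one>\<^bsub>mult_chars\<^esub>"
  shows "reduced_sum T = of_nat CARD('a) + (\<Sum>t\<in>UNIV. T t * quad_cubic_sum (t * (1 - t)))"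
proof -
  note q = quad_char_in_chars[OF two]
  let ?F = "\<lambda>x y. T (x * (1 - x)\<^sup>2 / (y * (1 - y)\<^sup>2)) *
      quad_char ((1 - x) * (1 - y) * ((1 - x) * (1 - y) - 4 * x * y))"
  let ?f = "\<lambda>t m. T t * quad_char (quartic t m)"
  have remove2: "(\<Sum>x\<in>UNIV - {a, b}. f x) = sum f UNIV - f a - f b" if "a \<noteq> b"
    for f :: "'a \<Rightarrow> complex" and a b
    using that by (simp add: sum_diff)
  have inner: "(\<Sum>t\<in>UNIV - {m\<^sup>2, m ^ 3}. ?f t m) =
      (\<Sum>t\<in>UNIV. ?f t m) - T m ^ 2 * quad_char m * quad_char (-1 :: 'a) - T m ^ 3 * quad_char (-3 :: 'a)"
    if "m \<in> UNIV - {0, 1}" for m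
  proof -
    have m: "m \<noteq> 0" "1 - m \<noteq> 0" using that by auto
    then have "m\<^sup>2 \<noteq> m ^ 3"
      by (simp add: power2_eq_square power3_eq_cube)
    then have "(\<Sum>t\<in>UNIV - {m\<^sup>2, m ^ 3}. ?f t m) = (\<Sum>t\<in>UNIV. ?f t m) - ?f (m\<^sup>2) m - ?f (m ^ 3) m"
      by (rule remove2)
    moreover have "quad_char (quartic (m\<^sup>2) m) = quad_char m * quad_char (-1 :: 'a)"
    proof -
      have "quartic (m\<^sup>2) m = (2 * m * (1 - m))\<^sup>2 * (m * -1)"
        by (simp add: quartic_eq power2_eq_square algebra_simps)
      then show ?thesis
        using quad_char_sq[of "2 * m * (1 - m)"] m two by (simp only: char_mult[OF q]) simp
    qed
    moreover have "quad_char (quartic (m ^ 3) m) = quad_char (-3 :: 'a)"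
    proof -
      have "quartic (m ^ 3) m = (m\<^sup>2 * (1 - m))\<^sup>2 * - 3"
        by (simp add: quartic_eq power2_eq_square power3_eq_cube algebra_simps)
      then show ?thesis
        using quad_char_sq[of "m\<^sup>2 * (1 - m)"] m by (simp only: char_mult[OF q]) simp
    qed
    ultimately show ?thesis
      by (simp add: char_power[OF T(1)] mult.assoc)
  qed
  have at_0: "(\<Sum>t\<in>UNIV. ?f t 0) = 0"
  proof -
    have "?f t 0 = T t" for t
      by (cases "t = 0") (simp_all add: quartic_def char_0[OF T(1)] quad_char_sq)
    then show ?thesis
      using sum_char[OF T(1,2)] by (simp only:)
  qed
  have at_1: "(\<Sum>t\<in>UNIV. ?f t 1) = -1"
  proof -
    have "?f t 1 = T t - (if t = 1 then 1 else 0)" for t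
    proof (cases "t = 1")
      case False
      have "quartic t 1 = (t - 1)\<^sup>2"
        by (simp add: quartic_eq)
      then show ?thesis
        using False quad_char_sq[of "t - 1"] by simp
    qed (simp add: quartic_eq char_1[OF T(1)])
    then have "(\<Sum>t\<in>UNIV. ?f t 1) = (\<Sum>t\<in>UNIV. T t - (if t = 1 then 1 else 0))"
      by (simp only:)
    then show ?thesis
      using sum_char[OF T(1,2)] by (simp add: sum_subtractf)
  qed
  have "(\<Sum>m\<in>UNIV. \<Sum>t\<in>UNIV. ?f t m) = (\<Sum>t\<in>UNIV. T t * (\<Sum>m\<in>UNIV. quad_char (quartic t m)))"
    unfolding sum_distrib_left by (rule sum.swap)
  also have "\<dots> = (\<Sum>t\<in>UNIV. T t * ((if t = 1 then of_nat CARD('a) else 0) - 1 + quad_cubic_sum (t * (1 - t))))"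
  proof (rule sum.cong[OF refl])
    fix t
    show "T t * (\<Sum>m\<in>UNIV. quad_char (quartic t m)) =
        T t * ((if t = 1 then of_nat CARD('a) else 0) - 1 + quad_cubic_sum (t * (1 - t)))"
      by (cases "t = 0") (simp_all add: char_0[OF T(1)] sum_quad_char_quartic[OF two three])
  qed
  also have "\<dots> = (\<Sum>t\<in>UNIV. (if t = 1 then of_nat CARD('a) else 0) - T t + T t * quad_cubic_sum (t * (1 - t)))"
    by (intro sum.cong) (auto simp: char_1[OF T(1)] algebra_simps)
  also have "\<dots> = of_nat CARD('a) + (\<Sum>t\<in>UNIV. T t * quad_cubic_sum (t * (1 - t)))"
    by (simp add: sum.distrib sum_subtractf sum_char[OF T(1,2)])
  finally have total: "(\<Sum>m\<in>UNIV. \<Sum>t\<in>UNIV. ?f t m) =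
      of_nat CARD('a) + (\<Sum>t\<in>UNIV. T t * quad_cubic_sum (t * (1 - t)))" .
  \<comment> \<open>A nontrivial character sums to 0, so deleting 0 and 1 leaves minus its value at
    1.\<close>
  have s2: "(\<Sum>m\<in>UNIV - {0, 1}. T m ^ 2 * quad_char m) = -1"
    using sum_char[OF mult_in_chars[OF power_in_chars[OF T(1), of 2] q] T2]
    by (simp add: remove2 char_1[OF T(1)])
  have s3: "(\<Sum>m\<in>UNIV - {0, 1}. T m ^ 3) = -1"
    using sum_char[OF power_in_chars[OF T(1), of 3] T(3)]
    by (simp add: remove2 char_1[OF T(1)] char_0[OF T(1)])
  have "(\<Sum>(x, y)\<in>{(x, y). x \<noteq> y}. ?F x y) = (\<Sum>m\<in>UNIV - {0, 1}.
      (\<Sum>t\<in>UNIV. ?f t m) - T m ^ 2 * quad_char m * quad_char (-1 :: 'a) - T m ^ 3 * quad_char (-3 :: 'a))"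
    unfolding reduced_sum_off_diagonal[OF two T(1)] by (intro sum.cong refl inner)
  also have "\<dots> = (\<Sum>m\<in>UNIV - {0, 1}. \<Sum>t\<in>UNIV. ?f t m) -
      (\<Sum>m\<in>UNIV - {0, 1}. T m ^ 2 * quad_char m) * quad_char (-1 :: 'a) -
      (\<Sum>m\<in>UNIV - {0, 1}. T m ^ 3) * quad_char (-3 :: 'a)"
    by (simp add: sum_subtractf sum_distrib_right)
  also have "\<dots> = of_nat CARD('a) + (\<Sum>t\<in>UNIV. T t * quad_cubic_sum (t * (1 - t))) + 1 +
      quad_char (-1 :: 'a) + quad_char (-3 :: 'a)"
    unfolding s2 s3 by (simp only: remove2 zero_neq_one not_False_eq_True total at_0 at_1) simp
  finally have off: "(\<Sum>(x, y)\<in>{(x, y). x \<noteq> y}. ?F x y) = \<dots>" .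
  have "reduced_sum T = (\<Sum>(x, y)\<in>{(x, y). x \<noteq> y}. ?F x y) + (\<Sum>(x, y)\<in>{(x, y). x = y}. ?F x y)"
    unfolding reduced_sum_def by (subst sum.union_disjoint[symmetric]) (auto intro!: sum.cong)
  also have "(\<Sum>(x, y)\<in>{(x, y). x = y}. ?F x y) = (\<Sum>x\<in>UNIV. ?F x x)"
    by (rule sum.reindex_bij_witness[of _ "\<lambda>x. (x, x)" fst]) auto
  finally show ?thesis
    unfolding off reduced_sum_diagonal[OF two T(1)] by simp
qed

subsection \<open>The hypergeometric series\<close>

lemma mult_chars_mult: "\<chi> \<otimes>\<^bsub>mult_chars\<^esub> \<psi> = (\<lambda>x. \<chi> x * \<psi> x)"
  by (rule ext) simp

lemma mult_chars_nat_pow: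
  assumes "\<chi> \<in> carrier mult_chars" "n > 0"
  shows "\<chi> [^]\<^bsub>mult_chars\<^esub> n = (\<lambda>x. \<chi> x ^ n)"
  using assms(2)
proof (induction n rule: nat_induct_non_zero)
  case 1
  show ?case
    using assms(1) by simp
next
  case (Suc n)
  then show ?case
    by (simp add: mult_chars_mult mult.commute)
qed

lemma mult_chars_neg_int_pow:
  assumes "\<chi> \<in> carrier mult_chars" "n > 0"
  shows "\<chi> [^]\<^bsub>mult_chars\<^esub> (- int n) = (\<lambda>x. inverse (\<chi> x) ^ n)"
  using assms by (simp add: mult_chars.int_pow_neg_int mult_chars_nat_pow mult_chars_inv power_in_chars
      power_inverse)

lemma char_binomial_eq:
  assumes "B \<in> carrier mult_chars"
  shows "char_binomial A B = B (-1) / of_nat CARD('a) * (\<Sum>x\<in>UNIV. A x * inverse (B (1 - x :: 'a::finite_field)))"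
  by (simp add: char_binomial_def jacobi_sum_def mult_chars_inv[OF assms])

text \<open>Once the Jacobi sums are opened, \<chi> enters only through its value at
  \<open>arg x y z\<close>. Orthogonality forces this argument to be 1, which determines z from x
  and y, and the resulting factor q - 1 cancels the one in the series.\<close>

lemma hypergeom_3F2_eq_reduced_sum:
  fixes T :: "'a::finite_field \<Rightarrow> complex"
  assumes two: "(2 :: 'a) \<noteq> 0" and T: "T \<in> carrier mult_chars"
  shows "hypergeom_3F2 (\<lambda>x. T x ^ 3) T (\<lambda>x. T x ^ 2 * quad_char x) (\<lambda>x. T x ^ 4) (\<lambda>x. T x ^ 2) 4 =
    T (1 / 16) / of_nat CARD('a) ^ 2 * reduced_sum T"
proof -
  note four = four_nonzero[OF two]
  note quad = quad_char_in_chars[OF two]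
  let ?q = "of_nat CARD('a) :: complex"
  have q0: "?q \<noteq> 0" "?q - 1 \<noteq> 0"
    using card_finite_field_ge_2[where 'a = 'a] by auto
  define W where "W x y z = T x ^ 3 * (T y * inverse (T (1 - y) ^ 4)) *
    (T z ^ 2 * quad_char z * inverse (T (1 - z) ^ 2))" for x y z
  \<comment> \<open>The -4 joins the argument 4 of the series to the three signs \<chi>(-1) of the
    binomials; the quotients come from \<chi>(x) / \<chi>(1 - x).\<close>
  define arg where "arg x y z = -4 * (x / (1 - x)) * (y / (1 - y)) * (z / (1 - z))" for x y z :: 'a
  have summand: "char_binomial (\<lambda>x. T x ^ 3 * \<chi> x) \<chi> *
      char_binomial (\<lambda>x. T x * \<chi> x) (\<lambda>x. T x ^ 4 * \<chi> x) *
      char_binomial (\<lambda>x. T x ^ 2 * quad_char x * \<chi> x) (\<lambda>x. T x ^ 2 * \<chi> x) * \<chi> 4 =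
      (\<Sum>x\<in>UNIV. \<Sum>y\<in>UNIV. \<Sum>z\<in>UNIV. W x y z * \<chi> (arg x y z)) / ?q ^ 3"
    if \<chi>: "\<chi> \<in> carrier mult_chars" for \<chi>
  proof -
    have T4: "(\<lambda>x. T x ^ 4 * \<chi> x) \<in> carrier mult_chars" and T2: "(\<lambda>x. T x ^ 2 * \<chi> x) \<in> carrier mult_chars"
      by (rule mult_in_chars[OF power_in_chars[OF T] \<chi>]; simp)+
    have "T (-1) ^ 2 = 1"
      using char_minus_1_sq[OF T] by (simp add: power2_eq_square)
    moreover from this have "T (-1) ^ 4 = 1"
      by (metis numeral_Bit0 one_power2 power2_eq_square power_add_numeral2 power_even_eq mult_2 mult_1)
    moreover have \<chi>1: "\<chi> (-1) * \<chi> (-1) = 1"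
      by (rule char_minus_1_sq[OF \<chi>])
    ultimately have sgn: "T (-1) ^ 4 * \<chi> (-1) = \<chi> (-1)" "T (-1) ^ 2 * \<chi> (-1) = \<chi> (-1)"
      by simp_all
    have \<chi>4: "\<chi> (-4) = \<chi> (-1) * \<chi> 4"
      using char_mult[OF \<chi>, of "-1" 4] by simp
    let ?a = "\<lambda>x. T x ^ 3 * \<chi> x * inverse (\<chi> (1 - x))"
    let ?b = "\<lambda>y. T y * \<chi> y * inverse (T (1 - y) ^ 4 * \<chi> (1 - y))"
    let ?c = "\<lambda>z. T z ^ 2 * quad_char z * \<chi> z * inverse (T (1 - z) ^ 2 * \<chi> (1 - z))"
    have "char_binomial (\<lambda>x. T x ^ 3 * \<chi> x) \<chi> *
        char_binomial (\<lambda>x. T x * \<chi> x) (\<lambda>x. T x ^ 4 * \<chi> x) *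
        char_binomial (\<lambda>x. T x ^ 2 * quad_char x * \<chi> x) (\<lambda>x. T x ^ 2 * \<chi> x) * \<chi> 4 =
        (\<chi> (-1) * \<chi> (-1)) * \<chi> (-4) * (sum ?a UNIV * (sum ?b UNIV * sum ?c UNIV)) / ?q ^ 3"
      unfolding char_binomial_eq[OF \<chi>] char_binomial_eq[OF T4] char_binomial_eq[OF T2] sgn \<chi>4
      by (simp add: power3_eq_cube)
    also have "\<dots> = (\<Sum>x\<in>UNIV. \<Sum>y\<in>UNIV. \<Sum>z\<in>UNIV. \<chi> (-4) * (?a x * (?b y * ?c z))) / ?q ^ 3"
    proof -
      have "sum f UNIV * (sum g UNIV * sum h UNIV) = (\<Sum>x\<in>UNIV. \<Sum>y\<in>UNIV. \<Sum>z\<in>UNIV. f x * (g y * h z))"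
        for f g h :: "'a \<Rightarrow> complex"
        by (simp only: sum_product) (simp only: sum_distrib_left)
      then show ?thesis
        unfolding \<chi>1 by (simp only: sum_distrib_left mult_1)
    qed
    also have "\<dots> = (\<Sum>x\<in>UNIV. \<Sum>y\<in>UNIV. \<Sum>z\<in>UNIV. W x y z * \<chi> (arg x y z)) / ?q ^ 3"
    proof -
      have "\<chi> (-4) * (?a x * (?b y * ?c z)) = W x y z * \<chi> (arg x y z)" for x y z
        unfolding W_def arg_def char_mult[OF \<chi>] char_divide[OF \<chi>] by (simp add: divide_inverse mult_ac)
      then show ?thesis by (simp only:)
    qed
    finally show ?thesis .
  qed
  have inner: "(\<Sum>z\<in>UNIV. W x y z * (if arg x y z = 1 then 1 else 0)) =
      T (1 / 16) * (T (x * (1 - x)\<^sup>2 / (y * (1 - y)\<^sup>2)) *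
        quad_char ((1 - x) * (1 - y) * ((1 - x) * (1 - y) - 4 * x * y)))" for x y
  proof (cases "x = 0 \<or> x = 1 \<or> y = 0 \<or> y = 1")
    case True
    then have "arg x y z \<noteq> 1" for z
      by (auto simp: arg_def)
    moreover have "T (x * (1 - x)\<^sup>2 / (y * (1 - y)\<^sup>2)) = 0"
      using True by (auto simp: char_0[OF T])
    ultimately show ?thesis
      by simp
  next
    case False
    then have xy: "x \<noteq> 0" "1 - x \<noteq> 0" "y \<noteq> 0" "1 - y \<noteq> 0" by auto
    define e where "e = (1 - x) * (1 - y)"
    define d where "d = 4 * x * y / e"
    have e: "e \<noteq> 0" and d: "d \<noteq> 0"
      using xy four by (simp_all add: e_def d_def)
    have arg: "arg x y z = - d * (z / (1 - z))" for z
      by (simp add: arg_def d_def e_def mult_ac)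
    \<comment> \<open>Division by zero rules out z = 1. Otherwise the equation reads z(1 - d) = 1,
      which has no solution for d = 1; there the quadratic character on the other side vanishes as
      well.\<close>
    have iff: "arg x y z = 1 \<longleftrightarrow> 1 - d \<noteq> 0 \<and> z = 1 / (1 - d)" for z
    proof (cases "z = 1")
      case True
      then show ?thesis
        using d by (auto simp: arg)
    next
      case False
      then have "arg x y z = 1 \<longleftrightarrow> - d * z = 1 - z"
        using divide_eq_eq[of "- d * z" "1 - z" 1] by (simp add: arg)
      also have "\<dots> \<longleftrightarrow> z * (1 - d) = 1"
        by (auto simp: algebra_simps)
      also have "\<dots> \<longleftrightarrow> 1 - d \<noteq> 0 \<and> z = 1 / (1 - d)"
        by (auto simp: eq_divide_eq)
      finally show ?thesis .
    qed
    have quad_eq: "quad_char (e * (e - 4 * x * y)) = quad_char (1 - d)"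
    proof -
      have "e * (e - 4 * x * y) = e\<^sup>2 * (1 - d)"
        using e by (simp add: d_def power2_eq_square right_diff_distrib)
      then show ?thesis
        using quad_char_sq[OF e] by (simp only: char_mult[OF quad, of "e\<^sup>2"]) simp
    qed
    show ?thesis
    proof (cases "1 - d = 0")
      case True
      then show ?thesis
        unfolding iff using quad_eq by (simp add: e_def)
    next
      case False
      let ?z = "1 / (1 - d)"
      have "1 - ?z = - d / (1 - d)"
        using diff_divide_distrib[of "1 - d" 1 "1 - d"] False by simp
      then have ratio: "?z / (1 - ?z) = - 1 / d"
        using False d by simp
      \<comment> \<open>Source of T(1/16): the weight T^2 at z squares the factor 4 contained in
        d.\<close>
      have ratio2: "(?z / (1 - ?z))\<^sup>2 = e\<^sup>2 / (16 * x\<^sup>2 * y\<^sup>2)"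
      proof -
        have "(- 1 / d)\<^sup>2 = e\<^sup>2 / (16 * x\<^sup>2 * y\<^sup>2)"
          by (simp add: d_def power_divide power_mult_distrib)
        then show ?thesis by (simp only: ratio)
      qed
      have quad_inv: "quad_char ?z = quad_char (1 - d)"
      proof -
        have "?z = (1 / (1 - d))\<^sup>2 * (1 - d)"
          using False by (simp add: power2_eq_square)
        then show ?thesis
          using quad_char_sq[of ?z] False by (metis char_mult[OF quad] divide_eq_0_iff mult_1 zero_neq_one)
      qed
      have "W x y ?z = T (x ^ 3 * (y / (1 - y) ^ 4) * (?z / (1 - ?z))\<^sup>2) * quad_char ?z"
        unfolding W_def char_mult[OF T] char_divide[OF T] char_power[OF T]
        by (simp add: divide_inverse power_inverse power_mult_distrib mult_ac)
      also have "x ^ 3 * (y / (1 - y) ^ 4) * (?z / (1 - ?z))\<^sup>2 =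
          1 / 16 * (x * (1 - x)\<^sup>2 / (y * (1 - y)\<^sup>2))"
        unfolding ratio2 e_def using xy
        by (simp add: power2_eq_square power3_eq_cube power4_eq_xxxx)
      finally have "W x y ?z = T (1 / 16) * (T (x * (1 - x)\<^sup>2 / (y * (1 - y)\<^sup>2)) *
          quad_char (e * (e - 4 * x * y)))"
        by (simp only: char_mult[OF T, of "1 / 16"] quad_inv quad_eq) (simp only: mult.assoc)
      moreover have "(\<Sum>z\<in>UNIV. W x y z * (if arg x y z = 1 then 1 else 0)) = W x y ?z"
      proof -
        have "W x y z * (if arg x y z = 1 then 1 else 0) = (if z = ?z then W x y ?z else 0)" for z
          unfolding iff using False by simp
        then show ?thesis by simp
      qed
      ultimately show ?thesis
        unfolding e_def[symmetric] by (simp only:)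
    qed
  qed
  have "hypergeom_3F2 (\<lambda>x. T x ^ 3) T (\<lambda>x. T x ^ 2 * quad_char x) (\<lambda>x. T x ^ 4) (\<lambda>x. T x ^ 2) 4 =
      ?q / (?q - 1) * (\<Sum>\<chi>\<in>carrier mult_chars.
        (\<Sum>x\<in>UNIV. \<Sum>y\<in>UNIV. \<Sum>z\<in>UNIV. W x y z * \<chi> (arg x y z)) / ?q ^ 3)"
    unfolding hypergeom_3F2_def mult_chars_mult by (simp only: summand cong: sum.cong)
  also have "(\<Sum>\<chi>\<in>carrier mult_chars.
        (\<Sum>x\<in>UNIV. \<Sum>y\<in>UNIV. \<Sum>z\<in>UNIV. W x y z * \<chi> (arg x y z)) / ?q ^ 3) =
      (\<Sum>x\<in>UNIV. \<Sum>y\<in>UNIV. \<Sum>z\<in>UNIV. W x y z * (\<Sum>\<chi>\<in>carrier mult_chars. \<chi> (arg x y z))) / ?q ^ 3"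
    unfolding sum_divide_distrib[symmetric] sum_distrib_left
    by (simp only: sum.swap[of _ _ "carrier mult_chars"])
  also have "\<dots> = (\<Sum>x\<in>UNIV. \<Sum>y\<in>UNIV. \<Sum>z\<in>UNIV. (?q - 1) * (W x y z * (if arg x y z = 1 then 1 else 0))) / ?q ^ 3"
    unfolding sum_over_chars by (intro arg_cong[of _ _ "\<lambda>s. s / ?q ^ 3"] sum.cong refl) simp
  also have "\<dots> = (?q - 1) * (T (1 / 16) * reduced_sum T) / ?q ^ 3"
    unfolding sum_distrib_left[symmetric] inner reduced_sum_def
    by (simp add: sum.cartesian_product)
  also have "?q / (?q - 1) * \<dots> = T (1 / 16) / ?q ^ 2 * reduced_sum T"
    using q0 by (simp add: power2_eq_square power3_eq_cube)
  finally show ?thesis .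
qed

text \<open>A square root y of -3 would give the primitive cube root of unity (y - 1)/2, which does
  not exist for this residue of q.\<close>

lemma quad_char_minus_3_eq_minus_1:
  assumes "CARD('a::finite_field) mod 3 = 2" and two: "(2 :: 'a) \<noteq> 0" and three: "(3 :: 'a) \<noteq> 0"
  shows "quad_char (-3 :: 'a) = -1"
proof -
  have "-3 \<noteq> y\<^sup>2" for y :: 'a
  proof
    assume y: "-3 = y\<^sup>2"
    define z where "z = (y - 1) / 2"
    have yz: "y = 2 * z + 1"
      using two by (simp add: z_def diff_divide_distrib)
    have "4 * (z\<^sup>2 + z + 1) = y\<^sup>2 + 3"
      unfolding yz by (simp add: power2_eq_square algebra_simps)
    then have "4 * (z\<^sup>2 + z + 1) = 0"
      unfolding y[symmetric] by simp
    then have "z\<^sup>2 + z + 1 = 0"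
      using four_nonzero[OF two] by (metis mult_eq_0_iff)
    moreover have "z ^ 3 - 1 = (z - 1) * (z\<^sup>2 + z + 1)"
      by (simp add: power2_eq_square power3_eq_cube algebra_simps)
    ultimately have "z ^ 3 = 1" by simp
    then have "z = 1"
      by (rule cube_eq_1D[OF assms(1)])
    with \<open>z\<^sup>2 + z + 1 = 0\<close> three show False by simp
  qed
  then show ?thesis
    using three by (auto simp: quad_char_def)
qed

lemma quad_char_minus_3_eq_1:
  fixes \<zeta> :: "'a::finite_field"
  assumes three: "(3 :: 'a) \<noteq> 0" and \<zeta>: "\<zeta> ^ 3 = 1" "\<zeta> \<noteq> 1"
  shows "quad_char (-3 :: 'a) = 1"
proof -
  have "(\<zeta> - 1) * (\<zeta>\<^sup>2 + \<zeta> + 1) = 0"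
    using \<zeta>(1) by (simp add: power2_eq_square power3_eq_cube algebra_simps)
  then have "\<zeta>\<^sup>2 + \<zeta> + 1 = 0"
    using \<zeta>(2) by simp
  moreover have "(2 * \<zeta> + 1)\<^sup>2 = 4 * (\<zeta>\<^sup>2 + \<zeta> + 1) - 3"
    by (simp add: power2_eq_square algebra_simps)
  ultimately have "-3 = (2 * \<zeta> + 1)\<^sup>2" by simp
  then show ?thesis
    using three by (auto simp: quad_char_def)
qed

text \<open>For the third claim, S^2 = phi would make the order a divisor of 4. Orders 1 and 4 are
  excluded, and order 2 would make phi itself trivial.\<close>

lemma char_nontrivial_if_ord:
  fixes S :: "'a::finite_field \<Rightarrow> complex"
  assumes two: "(2 :: 'a) \<noteq> 0" and S: "S \<in> carrier mult_chars"
    and ord: "group.ord mult_chars S \<notin> {1, 3, 4}"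
  shows "S \<noteq> \<one>\<^bsub>mult_chars\<^esub>" "(\<lambda>x. S x ^ 3) \<noteq> \<one>\<^bsub>mult_chars\<^esub>"
    and "(\<lambda>x. inverse (S x) ^ 2 * quad_char x) \<noteq> \<one>\<^bsub>mult_chars\<^esub>"
proof -
  have dvd: "group.ord mult_chars S dvd n" if "(\<lambda>x. S x ^ n) = \<one>\<^bsub>mult_chars\<^esub>" "n > 0" for n
    using mult_chars.pow_eq_id[OF S, of n] that by (simp add: mult_chars_nat_pow[OF S])
  show "(\<lambda>x. S x ^ 3) \<noteq> \<one>\<^bsub>mult_chars\<^esub>"
  proof
    assume "(\<lambda>x. S x ^ 3) = \<one>\<^bsub>mult_chars\<^esub>"
    then have "group.ord mult_chars S dvd 3" by (rule dvd) simp
    moreover have "prime (3 :: nat)" by simp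
    ultimately show False
      using ord by (auto simp: prime_nat_iff)
  qed
  show "S \<noteq> \<one>\<^bsub>mult_chars\<^esub>"
    using dvd[of 1] ord by auto
  show "(\<lambda>x. inverse (S x) ^ 2 * quad_char x) \<noteq> \<one>\<^bsub>mult_chars\<^esub>"
  proof
    assume eq: "(\<lambda>x. inverse (S x) ^ 2 * quad_char x) = \<one>\<^bsub>mult_chars\<^esub>"
    have sq: "S x ^ 2 = quad_char x" for x
    proof (cases "x = 0")
      case False
      then have "inverse (S x) ^ 2 * quad_char x = 1"
        using fun_cong[OF eq, of x] by simp
      then show ?thesis
        using False by (simp add: char_eq_0_iff[OF S] field_simps)
    qed (simp add: char_0[OF S])
    have "S x ^ 4 = \<one>\<^bsub>mult_chars\<^esub> x" for x
    proof -
      have "S x ^ 4 = (S x ^ 2) ^ 2"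
        by (simp flip: power_mult)
      then show ?thesis
        unfolding sq by (simp add: quad_char_def)
    qed
    then have "group.ord mult_chars S dvd 4"
      by (intro dvd) auto
    moreover from this have "group.ord mult_chars S \<le> 4"
      by (rule dvd_imp_le) simp
    moreover have "group.ord mult_chars S \<noteq> 0"
      using \<open>group.ord mult_chars S dvd 4\<close> by (metis dvd_0_left zero_neq_numeral)
    ultimately have "group.ord mult_chars S = 2"
      using ord by auto
    then have "(\<lambda>x. S x ^ 2) = \<one>\<^bsub>mult_chars\<^esub>"
      using mult_chars.pow_eq_id[OF S, of 2] by (simp add: mult_chars_nat_pow[OF S])
    then show False
      unfolding sq using quad_char_nontrivial[OF two] by simp
  qed
qed

text \<open>Each binomial inverts its lower character, so w and its square change places; their
  values at -1 are 1 and no sign remains.\<close>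

lemma char_binomial_sum_cubic:
  fixes S w :: "'a::finite_field \<Rightarrow> complex"
  assumes S: "S \<in> carrier mult_chars" "S \<noteq> \<one>\<^bsub>mult_chars\<^esub>"
    and w: "w \<in> carrier mult_chars" "w \<noteq> \<one>\<^bsub>mult_chars\<^esub>" "\<forall>x. x \<noteq> 0 \<longrightarrow> w x ^ 3 = 1"
  shows "char_binomial S w + char_binomial S (\<lambda>x. w x ^ 2) = cubic_char_sum S / of_nat CARD('a)"
proof -
  note sq = cubic_char_square[OF w]
  have "char_binomial S w = jacobi_sum S (\<lambda>x. w x ^ 2) / of_nat CARD('a)"
    by (simp add: char_binomial_def mult_chars_inv[OF w(1)] sq)
  moreover have "inverse (w x ^ 2) = w x" for x
    using sq(4)[of x] by (metis inverse_inverse_eq)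
  then have "char_binomial S (\<lambda>x. w x ^ 2) = jacobi_sum S w / of_nat CARD('a)"
    by (simp add: char_binomial_def mult_chars_inv[OF sq(1)] sq(5))
  ultimately show ?thesis
    by (simp add: cubic_char_sum_eq_jacobi_sum[OF w S] add_divide_distrib)
qed

theorem theorem1p7:
  fixes S :: "'a::finite_field \<Rightarrow> complex" and p r q :: nat
  assumes "prime p" and "odd p" and "q = p ^ r" and "CARD('a) = q"
    and "S \<in> carrier mult_chars"
    and "group.ord mult_chars S \<notin> {1, 3, 4}"
  shows
    "(q mod 3 = 2 \<longrightarrow>
        hypergeom_3F2
          (S [^]\<^bsub>mult_chars\<^esub> (-3::int)) (S [^]\<^bsub>mult_chars\<^esub> (-1::int))
          (S [^]\<^bsub>mult_chars\<^esub> (-2::int) \<otimes>\<^bsub>mult_chars\<^esub> quad_char)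
          (S [^]\<^bsub>mult_chars\<^esub> (-4::int)) (S [^]\<^bsub>mult_chars\<^esub> (-2::int)) 4
        = - (quad_char (-3 :: 'a) * S 16 / of_nat q)) \<and>
     (q mod 3 = 1 \<longrightarrow>
        (\<forall>\<chi>\<^sub>3 \<in> carrier mult_chars. group.ord mult_chars \<chi>\<^sub>3 = 3 \<longrightarrow>
          hypergeom_3F2
            (S [^]\<^bsub>mult_chars\<^esub> (-3::int)) (S [^]\<^bsub>mult_chars\<^esub> (-1::int))
            (S [^]\<^bsub>mult_chars\<^esub> (-2::int) \<otimes>\<^bsub>mult_chars\<^esub> quad_char)
            (S [^]\<^bsub>mult_chars\<^esub> (-4::int)) (S [^]\<^bsub>mult_chars\<^esub> (-2::int)) 4
          = S (- (16 / 27)) *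
              jacobi_sum (S [^]\<^bsub>mult_chars\<^esub> (-1::int)) (S [^]\<^bsub>mult_chars\<^esub> (-1::int)) /
              jacobi_sum (S [^]\<^bsub>mult_chars\<^esub> (-3::int)) S *
              (char_binomial S \<chi>\<^sub>3 + char_binomial S (\<chi>\<^sub>3 [^]\<^bsub>mult_chars\<^esub> (2::nat)))\<^sup>2
            - quad_char (-3 :: 'a) * S 16 / of_nat q))"
proof -
  note S = \<open>S \<in> carrier mult_chars\<close>
  have two: "(2 :: 'a) \<noteq> 0"
    using of_nat_prime_nonzero[of 2, where 'a = 'a] assms by simp
  have three: "(3 :: 'a) \<noteq> 0" if "q mod 3 \<noteq> 0"
    using of_nat_prime_nonzero[of 3, where 'a = 'a] assms that by (simp add: dvd_eq_mod_eq_0)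
  define T where "T = (\<lambda>x. inverse (S x))"
  have T: "T \<in> carrier mult_chars"
    unfolding T_def by (rule inverse_in_chars[OF S])
  note nontriv = char_nontrivial_if_ord[OF two S assms(6)]
  have T1: "T \<noteq> \<one>\<^bsub>mult_chars\<^esub>"
  proof
    assume eq: "T = \<one>\<^bsub>mult_chars\<^esub>"
    have "S x = \<one>\<^bsub>mult_chars\<^esub> x" for x
      using fun_cong[OF eq, of x] by (simp add: T_def split: if_splits)
    with nontriv(1) show False by blast
  qed
  have T3: "(\<lambda>x. T x ^ 3) \<noteq> \<one>\<^bsub>mult_chars\<^esub>"
  proof
    assume eq: "(\<lambda>x. T x ^ 3) = \<one>\<^bsub>mult_chars\<^esub>"
    have "S x ^ 3 = \<one>\<^bsub>mult_chars\<^esub> x" for x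
      using fun_cong[OF eq, of x] by (simp add: T_def power_inverse split: if_splits)
    with nontriv(2) show False by blast
  qed
  have T2: "(\<lambda>x. T x ^ 2 * quad_char x) \<noteq> \<one>\<^bsub>mult_chars\<^esub>"
    using nontriv(3) by (simp add: T_def)
  have pow: "S [^]\<^bsub>mult_chars\<^esub> (-1::int) = T" "S [^]\<^bsub>mult_chars\<^esub> (-2::int) = (\<lambda>x. T x ^ 2)"
    "S [^]\<^bsub>mult_chars\<^esub> (-3::int) = (\<lambda>x. T x ^ 3)" "S [^]\<^bsub>mult_chars\<^esub> (-4::int) = (\<lambda>x. T x ^ 4)"
    using mult_chars_neg_int_pow[OF S, of 1] mult_chars_neg_int_pow[OF S, of 2]
      mult_chars_neg_int_pow[OF S, of 3] mult_chars_neg_int_pow[OF S, of 4]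
    by (simp_all add: T_def)
  let ?F = "hypergeom_3F2 (S [^]\<^bsub>mult_chars\<^esub> (-3::int)) (S [^]\<^bsub>mult_chars\<^esub> (-1::int))
      (S [^]\<^bsub>mult_chars\<^esub> (-2::int) \<otimes>\<^bsub>mult_chars\<^esub> quad_char)
      (S [^]\<^bsub>mult_chars\<^esub> (-4::int)) (S [^]\<^bsub>mult_chars\<^esub> (-2::int)) 4"
  have T16: "T (1 / 16) = S 16"
    by (simp add: T_def char_divide[OF S] char_1[OF S])
  have F: "?F = S 16 / of_nat q ^ 2 * (of_nat q + (\<Sum>t\<in>UNIV. T t * quad_cubic_sum (t * (1 - t))))"
    if "q mod 3 \<noteq> 0"
    using hypergeom_3F2_eq_reduced_sum[OF two T] reduced_sum_eq[OF two three[OF that] T T1 T3 T2]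
    unfolding pow mult_chars_mult T16 assms(4) by simp
  have q0: "(of_nat q :: complex) \<noteq> 0"
    using assms(4) by (metis of_nat_eq_0_iff zero_less_card_finite less_irrefl)
  show ?thesis
  proof (intro conjI impI ballI)
    assume q: "q mod 3 = 2"
    then have "CARD('a) mod 3 = 2"
      using assms(4) by simp
    \<comment> \<open>All genus-one sums vanish, so the reduced sum is q and the series is S(16)/q;
      the sign -phi(-3) equals 1 here.\<close>
    from quad_cubic_sum_eq_0[OF this two] quad_char_minus_3_eq_minus_1[OF this two three] q
    show "?F = - (quad_char (-3 :: 'a) * S 16 / of_nat q)"
      using q0 F by (simp add: power2_eq_square)
  next
    fix w :: "'a \<Rightarrow> complex"
    assume q: "q mod 3 = 1" and w: "w \<in> carrier mult_chars" and ord: "group.ord mult_chars w = 3"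
    have w1: "w \<noteq> \<one>\<^bsub>mult_chars\<^esub>"
      using ord mult_chars.pow_eq_id[OF w, of 1] w by auto
    have w3: "\<forall>x. x \<noteq> 0 \<longrightarrow> w x ^ 3 = 1"
    proof (intro allI impI)
      fix x :: 'a assume "x \<noteq> 0"
      have "w [^]\<^bsub>mult_chars\<^esub> (3::nat) = \<one>\<^bsub>mult_chars\<^esub>"
        using mult_chars.pow_ord_eq_1[OF w] ord by simp
      from fun_cong[OF this, of x] show "w x ^ 3 = 1"
        using \<open>x \<noteq> 0\<close> by (simp add: mult_chars_nat_pow[OF w])
    qed
    obtain \<zeta> :: 'a where \<zeta>: "\<zeta> ^ 3 = 1" "\<zeta> \<noteq> 1"
      using cube_root_of_unity_exists[OF w w1 w3] by blast
    have three': "(3 :: 'a) \<noteq> 0"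
      using three q by simp
    have inv_T: "(\<lambda>x. inverse (T x)) = S"
      by (simp add: T_def)
    let ?q = "of_nat q :: complex" and ?J = "jacobi_sum (\<lambda>x. T x ^ 3) S"
    have ratio: "T (-27) * jacobi_sum T T / ?J * cubic_char_sum S = cubic_char_sum T"
      using jacobi_sum_ratio_times_cubic_char_sum[OF three' \<zeta> T T1 T3] unfolding inv_T .
    \<comment> \<open>The reduced sum has q where the product has 2q, which leaves -q; it becomes
      the last term of the theorem since phi(-3) = 1 here.\<close>
    have "?F = S 16 / ?q ^ 2 * (cubic_char_sum T * cubic_char_sum S - ?q)"
      using F q cubic_char_sum_times_inverse[OF w w1 w3 two T T1 T3] unfolding inv_T assms(4) by simp
    also have "\<dots> = S 16 * T (-27) * jacobi_sum T T / ?J * (cubic_char_sum S / ?q)\<^sup>2 - S 16 / ?q"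
      unfolding ratio[symmetric] using q0 by (simp add: power2_eq_square right_diff_distrib mult_ac)
    also have "S 16 * T (-27) = S (- (16 / 27))"
    proof -
      have "S (16 / (- 27)) = S 16 / S (- 27)"
        by (rule char_divide[OF S])
      moreover have "16 / (- 27) = - (16 / 27 :: 'a)" by simp
      ultimately have "S (- (16 / 27)) = S 16 / S (- 27)" by (simp only:)
      then show ?thesis
        unfolding T_def by (simp only: divide_inverse[of "S 16"])
    qed
    finally show "?F = S (- (16 / 27)) *
        jacobi_sum (S [^]\<^bsub>mult_chars\<^esub> (-1::int)) (S [^]\<^bsub>mult_chars\<^esub> (-1::int)) /
        jacobi_sum (S [^]\<^bsub>mult_chars\<^esub> (-3::int)) S *
        (char_binomial S w + char_binomial S (w [^]\<^bsub>mult_chars\<^esub> (2::nat)))\<^sup>2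
        - quad_char (-3 :: 'a) * S 16 / ?q"
      unfolding pow mult_chars_mult using char_binomial_sum_cubic[OF S nontriv(1) w w1 w3]
        quad_char_minus_3_eq_1[OF three' \<zeta>] by (simp add: mult_chars_nat_pow[OF w] assms(4))
  qed
qed

end
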